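(* Let $K \in \{\mathbb{R}, \mathbb{C}, \mathbb{H}\}$, and let $n_K = 3$ if $K = \mathbb{R}$ and $n_K = 2$ if $K = \mathbb{C}$ or $K=\mathbb{H}$. Then for every integer $n \geq n_K$ and every integer $k$ with $1 \leq k \leq n-1$, the Grassmann manifold $Gr_k K^n$ is $G(n,K)$-paradoxical.
   Context: $\mathbb{H}$ denotes the quaternion algebra. For $K = \mathbb{R}, \mathbb{C}, \mathbb{H}$, $K^n$ is regarded as an $n$-dimensional right $K$-vector space with inner product $(x,y) := \bar{x}_1 y_1 + \cdots + \bar{x}_n y_n$ for $x,y\in K^n$ and metric $d(x,y) := \sqrt{(x-y,x-y)}$. $G(n,K)$ denotes the group of $K$-linear isometries of $K^n$, i.e. $O(n)$, $U(n)$, $Sp(n)$ for $K = \mathbb{R}, \mathbb{C}, \mathbb{H}$ respectively (acting on column vectors by left matrix multiplication). $Gr_k K^n$ is the set of all $k$-dimensional right $K$-subspaces of $K^n$, on which $G(n,K)$ acts by $g\cdot V = gV$. Let a group $G$ act on a non-empty set $X$. Non-empty subsets $A, B \subset X$ are called $G$-equidecomposable if there exist finitely many elements $g_1, \ldots, g_m \in G$ and partitions $A = \bigsqcup_{i=1}^m A_i$, $B = \bigsqcup_{i=1}^m B_i$ such that $A_i = g_i B_i$ for all $i$. A non-empty subset $E \subset X$ is called $G$-paradoxical if there exist disjoint subsets $A, B \subset E$ such that $A$ is $G$-equidecomposable to $E$ and $B$ is $G$-equidecomposable to $E$. (Here $E$ is the whole set $X$.) *)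

theory Defs
  imports
    Complex_Main
    "HOL-Library.Disjoint_Sets"
    "HOL-Analysis.Finite_Cartesian_Product"
    "HOL-Algebra.Group_Action"
begin

section \<open>Quaternions\<close>

datatype quat = Quat (qRe: real) (qI: real) (qJ: real) (qK: real)

lemma quat_eq_iff: "x = y \<longleftrightarrow> qRe x = qRe y \<and> qI x = qI y \<and> qJ x = qJ y \<and> qK x = qK y"
  by (cases x; cases y) auto

instantiation quat :: real_div_algebra
begin

definition zero_quat :: quat where "0 = Quat 0 0 0 0"

definition one_quat :: quat where "1 = Quat 1 0 0 0"

definition plus_quat :: "quat \<Rightarrow> quat \<Rightarrow> quat" where
  "x + y = Quat (qRe x + qRe y) (qI x + qI y) (qJ x + qJ y) (qK x + qK y)"

definition uminus_quat :: "quat \<Rightarrow> quat" where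
  "- x = Quat (- qRe x) (- qI x) (- qJ x) (- qK x)"

definition minus_quat :: "quat \<Rightarrow> quat \<Rightarrow> quat" where
  "x - y = Quat (qRe x - qRe y) (qI x - qI y) (qJ x - qJ y) (qK x - qK y)"

definition times_quat :: "quat \<Rightarrow> quat \<Rightarrow> quat" where
  "x * y = Quat
     (qRe x * qRe y - qI x * qI y - qJ x * qJ y - qK x * qK y)
     (qRe x * qI y + qI x * qRe y + qJ x * qK y - qK x * qJ y)
     (qRe x * qJ y - qI x * qK y + qJ x * qRe y + qK x * qI y)
     (qRe x * qK y + qI x * qJ y - qJ x * qI y + qK x * qRe y)"

definition scaleR_quat :: "real \<Rightarrow> quat \<Rightarrow> quat" where
  "scaleR r x = Quat (r * qRe x) (r * qI x) (r * qJ x) (r * qK x)"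

definition inverse_quat :: "quat \<Rightarrow> quat" where
  "inverse x = scaleR (1 / ((qRe x)\<^sup>2 + (qI x)\<^sup>2 + (qJ x)\<^sup>2 + (qK x)\<^sup>2))
     (Quat (qRe x) (- qI x) (- qJ x) (- qK x))"

definition divide_quat :: "quat \<Rightarrow> quat \<Rightarrow> quat" where
  "x div y = x * inverse (y :: quat)"

lemmas quat_defs = zero_quat_def one_quat_def plus_quat_def uminus_quat_def minus_quat_def
  times_quat_def scaleR_quat_def

lemma quat_norm_sq_pos:
  "x \<noteq> 0 \<Longrightarrow> (qRe x)\<^sup>2 + (qI x)\<^sup>2 + (qJ x)\<^sup>2 + (qK x)\<^sup>2 > 0"
  by (auto simp: quat_eq_iff zero_quat_def add_pos_nonneg add_nonneg_pos)

instance
proof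
  fix x :: quat
  assume nz: "x \<noteq> 0"
  define N where "N = (qRe x)\<^sup>2 + (qI x)\<^sup>2 + (qJ x)\<^sup>2 + (qK x)\<^sup>2"
  have "N \<noteq> 0" using quat_norm_sq_pos[OF nz] by (simp add: N_def)
  then have N: "qRe x * qRe x / N + qI x * qI x / N + qJ x * qJ x / N + qK x * qK x / N = 1"
    by (simp add: N_def power2_eq_square flip: add_divide_distrib)
  have inv: "inverse x = Quat (qRe x / N) (- qI x / N) (- qJ x / N) (- qK x / N)"
    by (simp add: inverse_quat_def scaleR_quat_def N_def)
  show "inverse x * x = 1" "x * inverse x = 1"
    unfolding inv using N by (simp_all add: quat_defs algebra_simps)
qed (simp_all add: quat_eq_iff quat_defs divide_quat_def inverse_quat_def algebra_simps)

end


section \<open>The scalars \<open>\<real>\<close>, \<open>\<complex>\<close> and the quaternions, with conjugation\<close>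

class conj_div_algebra = real_div_algebra +
  fixes conjK :: "'a \<Rightarrow> 'a"
    and reK :: "'a \<Rightarrow> real"
  assumes conjK_add: "conjK (x + y) = conjK x + conjK y"
    and conjK_mult: "conjK (x * y) = conjK y * conjK x"
    and conjK_conjK: "conjK (conjK x) = x"
    and add_conjK: "x + conjK x = scaleR (2 * reK x) 1"
    and reK_conjK_mult_pos: "x \<noteq> 0 \<Longrightarrow> reK (conjK x * x) > 0"

instantiation real :: conj_div_algebra
begin
definition conjK_real :: "real \<Rightarrow> real" where "conjK_real x = x"
definition reK_real :: "real \<Rightarrow> real" where "reK_real x = x"
instance
  by standard (auto simp: conjK_real_def reK_real_def not_less mult_le_0_iff zero_less_mult_iff)
end

instantiation complex :: conj_div_algebra
begin
definition conjK_complex :: "complex \<Rightarrow> complex" where "conjK_complex = cnj"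
definition reK_complex :: "complex \<Rightarrow> real" where "reK_complex = Re"
instance
  by standard
    (auto simp: conjK_complex_def reK_complex_def complex_eq_iff add_pos_nonneg add_nonneg_pos
      simp flip: power2_eq_square)
end

instantiation quat :: conj_div_algebra
begin
definition conjK_quat :: "quat \<Rightarrow> quat" where
  "conjK_quat x = Quat (qRe x) (- qI x) (- qJ x) (- qK x)"
definition reK_quat :: "quat \<Rightarrow> real" where "reK_quat = qRe"
instance
proof
  fix x y :: quat
  show "x + conjK x = scaleR (2 * reK x) 1"
    by (simp add: conjK_quat_def reK_quat_def quat_defs)
  show "x \<noteq> 0 \<Longrightarrow> reK (conjK x * x) > 0"
    using quat_norm_sq_pos[of x]
    by (simp add: conjK_quat_def reK_quat_def times_quat_def power2_eq_square)
qed (simp_all add: quat_eq_iff conjK_quat_def quat_defs algebra_simps)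
end


section \<open>The right vector space \<open>K\<^sup>n\<close> and its Grassmannians\<close>

text \<open>The library's vector spaces have commutative scalars, so the linear algebra of the right
  \<open>K\<close>-space \<open>K\<^sup>n\<close> is spelled out.\<close>

definition rscale :: "'a::times ^ 'n \<Rightarrow> 'a \<Rightarrow> 'a ^ 'n" where
  "rscale x c = (\<chi> i. x $ i * c)"

definition right_subspace :: "('a::ring_1 ^ 'n) set \<Rightarrow> bool" where
  "right_subspace V \<longleftrightarrow>
     0 \<in> V \<and> (\<forall>x\<in>V. \<forall>y\<in>V. x + y \<in> V) \<and> (\<forall>x\<in>V. \<forall>c. rscale x c \<in> V)"

text \<open>The next two definitions are meant for finite \<open>B\<close> only.\<close>

definition right_span :: "('a::ring_1 ^ 'n) set \<Rightarrow> ('a ^ 'n) set" where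
  "right_span B = range (\<lambda>c. \<Sum>v\<in>B. rscale v (c v))"

definition right_independent :: "('a::ring_1 ^ 'n) set \<Rightarrow> bool" where
  "right_independent B \<longleftrightarrow> (\<forall>c. (\<Sum>v\<in>B. rscale v (c v)) = 0 \<longrightarrow> (\<forall>v\<in>B. c v = 0))"

definition has_right_dim :: "('a::ring_1 ^ 'n) set \<Rightarrow> nat \<Rightarrow> bool" where
  "has_right_dim V k \<longleftrightarrow>
     (\<exists>B. finite B \<and> card B = k \<and> right_independent B \<and> right_span B = V)"

definition Gr :: "nat \<Rightarrow> ('a::ring_1 ^ 'n) set set" where
  "Gr k = {V. right_subspace V \<and> has_right_dim V k}"


section \<open>The group of \<open>K\<close>-linear isometries\<close>

definition innerK :: "'a::conj_div_algebra ^ 'n \<Rightarrow> 'a ^ 'n \<Rightarrow> 'a" where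
  "innerK x y = (\<Sum>i\<in>UNIV. conjK (x $ i) * y $ i)"

text \<open>\<open>innerK z z\<close> is always a real scalar; \<open>reK\<close> only reads it off as an element
  of type \<open>real\<close>.\<close>

lemma innerK_self: "innerK z z = of_real (reK (innerK z z))"
proof -
  have zero: "conjK (0::'a) = 0"
    using conjK_add[of "0::'a" 0] by simp
  have sum: "conjK (\<Sum>i\<in>A. f i) = (\<Sum>i\<in>A. conjK (f i))" for A :: "'b set" and f :: "'b \<Rightarrow> 'a"
    by (induction A rule: infinite_finite_induct) (simp_all add: zero conjK_add)
  have "conjK (innerK z z) = innerK z z"
    unfolding innerK_def sum by (simp add: conjK_mult conjK_conjK)
  then have "2 *\<^sub>R innerK z z = 2 *\<^sub>R of_real (reK (innerK z z))"
    using add_conjK[of "innerK z z"] by (simp add: of_real_def flip: scaleR_2)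
  then show ?thesis by simp
qed

definition distK :: "'a::conj_div_algebra ^ 'n \<Rightarrow> 'a ^ 'n \<Rightarrow> real" where
  "distK x y = sqrt (reK (innerK (x - y) (x - y)))"

definition right_linear :: "('a::ring_1 ^ 'n \<Rightarrow> 'a ^ 'n) \<Rightarrow> bool" where
  "right_linear f \<longleftrightarrow>
     (\<forall>x y. f (x + y) = f x + f y) \<and> (\<forall>x c. f (rscale x c) = rscale (f x) c)"

text \<open>An isometry of \<open>K\<^sup>n\<close> onto itself; bijectivity is automatic in finite dimension and is included
  so that the group laws are immediate. For the three scalar types this is \<open>O(n)\<close>, \<open>U(n)\<close>, \<open>Sp(n)\<close>.\<close>

definition isometry_group :: "('a::conj_div_algebra ^ 'n \<Rightarrow> 'a ^ 'n) monoid" where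
  "isometry_group =
     \<lparr>carrier = {f. right_linear f \<and> bij f \<and> (\<forall>x y. distK (f x) (f y) = distK x y)},
      mult = (\<circ>), one = id\<rparr>"

lemma group_isometry_group: "group (isometry_group :: ('a::conj_div_algebra ^ 'n \<Rightarrow> 'a ^ 'n) monoid)"
proof (rule groupI)
  fix f :: "'a ^ 'n \<Rightarrow> 'a ^ 'n"
  assume "f \<in> carrier isometry_group"
  then have lin: "right_linear f" and bij: "bij f" and iso: "\<And>x y. distK (f x) (f y) = distK x y"
    by (auto simp: isometry_group_def)
  have f: "f (inv_into UNIV f x) = x" "inv_into UNIV f (f x) = x" for x
    using bij by (simp_all add: bij_is_surj bij_is_inj surj_f_inv_f)
  have "inv_into UNIV f (x + y) = inv_into UNIV f x + inv_into UNIV f y" "inv_into UNIV f (rscale x c) = rscale (inv_into UNIV f x) c" for x y c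
    using lin f unfolding right_linear_def by metis+
  moreover have "distK (inv_into UNIV f x) (inv_into UNIV f y) = distK x y" for x y
    using iso f by metis
  moreover have "bij (inv_into UNIV f)" using bij by (rule bij_imp_bij_inv)
  ultimately show "\<exists>g\<in>carrier isometry_group. g \<otimes>\<^bsub>isometry_group\<^esub> f = \<one>\<^bsub>isometry_group\<^esub>"
    using f by (intro bexI[of _ "inv_into UNIV f"]) (auto simp: isometry_group_def right_linear_def fun_eq_iff)
qed (auto simp: isometry_group_def right_linear_def bij_comp)

lemma image_mem_Gr:
  fixes V :: "('a::conj_div_algebra ^ 'n) set"
  assumes g: "g \<in> carrier isometry_group" and V: "V \<in> Gr k"
  shows "g ` V \<in> Gr k"
proof -
  have add: "g (x + y) = g x + g y" and sc: "g (rscale x c) = rscale (g x) c" and bij: "bij g" for x y c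
    using g by (auto simp: isometry_group_def right_linear_def)
  have zero: "g 0 = 0" using add[of 0 0] by simp
  have sum: "g (\<Sum>v\<in>A. h v) = (\<Sum>v\<in>A. g (h v))" for A :: "('a ^ 'n) set" and h
    by (induction A rule: infinite_finite_induct) (simp_all add: zero add)
  have inj: "inj_on g A" for A using bij by (meson bij_is_inj inj_on_subset subset_UNIV)
  from V obtain B where sub: "right_subspace V"
    and B: "finite B" "card B = k" "right_independent B" "right_span B = V"
    by (auto simp: Gr_def has_right_dim_def)
  have comb: "(\<Sum>v\<in>g ` B. rscale v (c v)) = g (\<Sum>v\<in>B. rscale v (c (g v)))" for c
    by (simp add: sum.reindex[OF inj] sum sc)
  have "right_subspace (g ` V)"
    unfolding right_subspace_def
  proof (intro conjI ballI allI)
    show "0 \<in> g ` V" using sub zero by (force simp: right_subspace_def)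
  next
    fix x y assume "x \<in> g ` V" "y \<in> g ` V"
    then show "x + y \<in> g ` V" using sub by (auto simp: right_subspace_def simp flip: add)
  next
    fix x c assume "x \<in> g ` V"
    then show "rscale x c \<in> g ` V" using sub by (auto simp: right_subspace_def simp flip: sc)
  qed
  moreover have "right_independent (g ` B)"
    unfolding right_independent_def comb
  proof (intro allI impI)
    fix c assume "g (\<Sum>v\<in>B. rscale v (c (g v))) = 0"
    then have "(\<Sum>v\<in>B. rscale v (c (g v))) = 0"
      using zero inj[of UNIV] by (metis UNIV_I inj_onD)
    then show "\<forall>v\<in>g ` B. c v = 0"
      using B(3) unfolding right_independent_def by (auto dest: spec[of _ "\<lambda>v. c (g v)"])
  qed
  moreover have "right_span (g ` B) = g ` V"
  proof -
    have "(\<Sum>v\<in>B. rscale v (c v)) = (\<Sum>v\<in>B. rscale v ((c \<circ> inv_into UNIV g) (g v)))" for c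
      using bij by (simp add: bij_is_inj)
    then have "range (\<lambda>c. \<Sum>v\<in>B. rscale v (c (g v))) = right_span B"
      unfolding right_span_def by (auto simp del: comp_apply)
    then show ?thesis
      unfolding right_span_def comb B(4)[symmetric] by (metis image_image)
  qed
  moreover have "finite (g ` B)" "card (g ` B) = k"
    using B by (simp_all add: card_image[OF inj])
  ultimately show ?thesis unfolding Gr_def has_right_dim_def by blast
qed

lemma group_action_Gr:
  "group_action isometry_group (Gr k :: ('a::conj_div_algebra ^ 'n) set set)
     (\<lambda>g. restrict ((`) g) (Gr k))"
proof -
  let ?G = "isometry_group :: ('a ^ 'n \<Rightarrow> 'a ^ 'n) monoid"
  interpret group ?G by (rule group_isometry_group)
  have Bij: "restrict ((`) g) (Gr k) \<in> Bij (Gr k)" if g: "g \<in> carrier ?G" for g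
  proof -
    obtain h where h: "h \<in> carrier ?G" "h \<circ> g = id" "g \<circ> h = id"
      using l_inv[OF g] r_inv[OF g] inv_closed[OF g] by (auto simp: isometry_group_def)
    have "bij_betw ((`) g) (Gr k) (Gr k)"
      by (rule bij_betw_byWitness[where f' = "(`) h"])
        (use g h image_mem_Gr in \<open>auto simp: image_comp\<close>)
    then show ?thesis by (simp add: Bij_def)
  qed
  show ?thesis
    unfolding group_action_def group_hom_def group_hom_axioms_def
  proof (intro conjI homI)
    show "group ?G" by (rule group_isometry_group)
    show "group (BijGroup (Gr k :: ('a ^ 'n) set set))" by (rule group_BijGroup)
    fix g h assume gh: "g \<in> carrier ?G" "h \<in> carrier ?G"
    then show "restrict ((`) g) (Gr k) \<in> carrier (BijGroup (Gr k))"
      using Bij by (simp add: BijGroup_def)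
    show "restrict ((`) (g \<otimes>\<^bsub>?G\<^esub> h)) (Gr k) =
        restrict ((`) g) (Gr k) \<otimes>\<^bsub>BijGroup (Gr k)\<^esub> restrict ((`) h) (Gr k)"
      using gh Bij image_mem_Gr
      by (auto simp: BijGroup_def compose_def fun_eq_iff isometry_group_def)
  qed
qed


section \<open>Equidecomposability and paradoxical sets\<close>

text \<open>Pieces \<open>P i\<close>, \<open>Q i\<close> may be empty (then both are); dropping them does not change the notion.\<close>

definition equidecomposable ::
    "('g, 'm) monoid_scheme \<Rightarrow> ('g \<Rightarrow> 'x \<Rightarrow> 'x) \<Rightarrow> 'x set \<Rightarrow> 'x set \<Rightarrow> bool" where
  "equidecomposable G \<phi> A B \<longleftrightarrow> A \<noteq> {} \<and> B \<noteq> {} \<and>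
     (\<exists>(m::nat) g P Q.
        disjoint_family_on P {..<m} \<and> (\<Union>i<m. P i) = A \<and>
        disjoint_family_on Q {..<m} \<and> (\<Union>i<m. Q i) = B \<and>
        (\<forall>i<m. g i \<in> carrier G \<and> P i = \<phi> (g i) ` Q i))"

definition paradoxical ::
    "('g, 'm) monoid_scheme \<Rightarrow> ('g \<Rightarrow> 'x \<Rightarrow> 'x) \<Rightarrow> 'x set \<Rightarrow> bool" where
  "paradoxical G \<phi> E \<longleftrightarrow> E \<noteq> {} \<and>
     (\<exists>A B. A \<subseteq> E \<and> B \<subseteq> E \<and> A \<inter> B = {} \<and>
        equidecomposable G \<phi> A E \<and> equidecomposable G \<phi> B E)"

end

theory Submission imports Defs begin

text \<open>A space is paradoxical once it carries two piecewise-\<open>G\<close> injections into itself with disjoint images,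
  and finite unions of sets with this property have it too. Let the words in two letters and their
  inverses act through a group of unit quaternions and, at the same time, through Sanov's subgroup of \<open>SL\<^sub>2(\<int>)\<close>. If the words fixing a
  point always commute in \<open>SL\<^sub>2(\<int>)\<close>, they share a real eigenline, because Sanov's group has no elliptic
  elements; this gives an equivariant map to the projective line, where ping-pong yields the four pieces.
  The letters \<open>(1 \<plusminus> 2i)/\<surd>5\<close>, \<open>(1 \<plusminus> 2j)/\<surd>5\<close> generate a free group, so words that commute as quaternions
  commute in \<open>SL\<^sub>2(\<int>)\<close>.

  Let now the unit quaternions act on \<open>K\<^sup>n\<close> by isometries. If two noncommuting words fix a subspace \<open>V\<close>, then
  so does the whole Lie algebra of imaginary quaternions, since two noncommuting imaginary quaternions
  generate it. Hence the set of all \<open>V\<close> that are not invariant under the Lie algebra is paradoxical. Finitely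
  many such actions, on at most three coordinates at a time, leave no subspace other than \<open>0\<close> and \<open>K\<^sup>n\<close>
  invariant under all of them.\<close>

section \<open>Doubling maps\<close>

locale total_action = group G for G (structure) +
  fixes \<phi> :: "'a \<Rightarrow> 'x \<Rightarrow> 'x"
  assumes act_one: "\<phi> \<one> x = x"
    and act_mult: "g \<in> carrier G \<Longrightarrow> h \<in> carrier G \<Longrightarrow> \<phi> (g \<otimes> h) x = \<phi> g (\<phi> h x)"
begin

text \<open>Only the finiteness of the set of group elements is recorded. Explicit pieces are
  recovered in \<open>equidecomposable_image\<close>.\<close>

definition piecewise :: "'x set \<Rightarrow> ('x \<Rightarrow> 'x) \<Rightarrow> bool" where
  "piecewise E f \<longleftrightarrow> (\<exists>S. finite S \<and> S \<subseteq> carrier G \<and> (\<forall>x\<in>E. \<exists>g\<in>S. f x = \<phi> g x))"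

text \<open>The empty set qualifies, which starts the induction over finite unions; nonemptiness
  enters only when paradoxicality is concluded.\<close>

definition doubling :: "'x set \<Rightarrow> bool" where
  "doubling E \<longleftrightarrow> (\<exists>f h. piecewise E f \<and> piecewise E h \<and> inj_on f E \<and> inj_on h E \<and>
     f ` E \<subseteq> E \<and> h ` E \<subseteq> E \<and> f ` E \<inter> h ` E = {})"

lemma piecewise_id: "piecewise E (\<lambda>x. x)"
  unfolding piecewise_def by (rule exI[of _ "{\<one>}"]) (simp add: act_one)

lemma piecewise_act: "g \<in> carrier G \<Longrightarrow> piecewise E (\<phi> g)"
  unfolding piecewise_def by (rule exI[of _ "{g}"]) simp

lemma piecewise_subset: "piecewise E f \<Longrightarrow> F \<subseteq> E \<Longrightarrow> piecewise F f"
  unfolding piecewise_def by blast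

lemma piecewise_comp:
  assumes "piecewise E f" "piecewise F h" "f ` E \<subseteq> F"
  shows "piecewise E (\<lambda>x. h (f x))"
proof -
  obtain S T where S: "finite S" "S \<subseteq> carrier G" "\<forall>x\<in>E. \<exists>g\<in>S. f x = \<phi> g x"
    and T: "finite T" "T \<subseteq> carrier G" "\<forall>x\<in>F. \<exists>g\<in>T. h x = \<phi> g x"
    using assms unfolding piecewise_def by blast
  have "\<exists>k\<in>(\<lambda>(g, h). g \<otimes> h) ` (T \<times> S). h (f x) = \<phi> k x" if x: "x \<in> E" for x
  proof -
    obtain g where g: "g \<in> S" "f x = \<phi> g x" using S(3) x by blast
    obtain k where k: "k \<in> T" "h (f x) = \<phi> k (f x)"
      using T(3) assms(3) x by blast
    have "k \<in> carrier G" "g \<in> carrier G" using g(1) k(1) S(2) T(2) by auto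
    then have "h (f x) = \<phi> (k \<otimes> g) x" using g(2) k(2) by (simp add: act_mult)
    moreover have "k \<otimes> g \<in> (\<lambda>(g, h). g \<otimes> h) ` (T \<times> S)" using g(1) k(1) by auto
    ultimately show ?thesis by blast
  qed
  moreover have "(\<lambda>(g, h). g \<otimes> h) ` (T \<times> S) \<subseteq> carrier G" using S T by auto
  ultimately show ?thesis
    unfolding piecewise_def using S T by (intro exI[of _ "(\<lambda>(g, h). g \<otimes> h) ` (T \<times> S)"]) auto
qed

lemma piecewise_if:
  assumes "piecewise {x \<in> E. P x} f" "piecewise {x \<in> E. \<not> P x} h"
  shows "piecewise E (\<lambda>x. if P x then f x else h x)"
proof -
  obtain S T where S: "finite S" "S \<subseteq> carrier G" "\<forall>x\<in>{x \<in> E. P x}. \<exists>g\<in>S. f x = \<phi> g x"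
    and T: "finite T" "T \<subseteq> carrier G" "\<forall>x\<in>{x \<in> E. \<not> P x}. \<exists>g\<in>T. h x = \<phi> g x"
    using assms unfolding piecewise_def by blast
  then show ?thesis
    unfolding piecewise_def by (intro exI[of _ "S \<union> T"]) auto
qed

lemma doubling_Un:
  assumes A: "doubling A" and B: "doubling B"
  shows "doubling (A \<union> B)"
proof -
  obtain f h where f: "piecewise A f" "inj_on f A" "f ` A \<subseteq> A"
    and h: "piecewise A h" "inj_on h A" "h ` A \<subseteq> A" and fh: "f ` A \<inter> h ` A = {}"
    using A unfolding doubling_def by (elim exE conjE) (rule that)
  obtain p q where p: "piecewise B p" "inj_on p B" "p ` B \<subseteq> B"
    and q: "piecewise B q" "inj_on q B" "q ` B \<subseteq> B" and pq: "p ` B \<inter> q ` B = {}"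
    using B unfolding doubling_def by (elim exE conjE) (rule that)
  \<comment> \<open>Three of the four compositions of \<open>f\<close> and \<open>h\<close> embed disjoint copies of \<open>A\<close> into itself: two
    double \<open>A\<close>, the third makes room for the points of \<open>A \<inter> B\<close> hit from \<open>B - A\<close>.\<close>
  define r where "r y = (if y \<in> A then f y else y)" for y
  define H where "H u v x = (if x \<in> A then h (u x) else r (v x))" for u v :: "'x \<Rightarrow> 'x" and x
  have r_inj: "inj_on r (A \<union> B)"
    using f(2,3) unfolding inj_on_def r_def by auto
  have r_pw: "piecewise B r"
    unfolding r_def
    by (intro piecewise_if piecewise_id piecewise_subset[OF f(1)]) auto
  have pw: "piecewise (A \<union> B) (H u v)"
    if u: "piecewise A u" "u ` A \<subseteq> A" and v: "piecewise B v" "v ` B \<subseteq> B" for u v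
    unfolding H_def
  proof (rule piecewise_if)
    show "piecewise {x \<in> A \<union> B. x \<in> A} (\<lambda>x. h (u x))"
      by (rule piecewise_subset[OF piecewise_comp[OF u(1) h(1) u(2)]]) auto
    show "piecewise {x \<in> A \<union> B. x \<notin> A} (\<lambda>x. r (v x))"
      by (rule piecewise_subset[OF piecewise_comp[OF v(1) r_pw v(2)]]) auto
  qed
  have rA: "r y \<in> A \<Longrightarrow> r y \<in> f ` A" for y unfolding r_def by (auto split: if_splits)
  have img: "H u v ` (A \<union> B) \<subseteq> A \<union> B" if "u ` A \<subseteq> A" "v ` B \<subseteq> B" for u v
    using that h(3) f(3) unfolding H_def r_def image_subset_iff by auto
  \<comment> \<open>Values on \<open>A\<close> land in \<open>h\<close>
    A\<open>, whereas a value of\<close>r\<open>that lies in\<close>A\<open>lies in\<close>f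
    \<open>A\<close>.\<close>
  have sep: "h (u x) \<noteq> r (v y)" if "x \<in> A" "u ` A \<subseteq> A" for u v x y
  proof
    assume "h (u x) = r (v y)"
    moreover have "h (u x) \<in> h ` A" using that by auto
    ultimately show False using rA[of "v y"] h(3) fh by auto
  qed
  have inj: "inj_on (H u v) (A \<union> B)"
    if u: "inj_on u A" "u ` A \<subseteq> A" and v: "inj_on v B" "v ` B \<subseteq> B" for u v
  proof (rule inj_onI)
    fix x y assume x: "x \<in> A \<union> B" and y: "y \<in> A \<union> B" and eq: "H u v x = H u v y"
    have "x \<in> A \<longleftrightarrow> y \<in> A"
      using eq sep[OF _ u(2)] unfolding H_def by (metis (full_types))
    then show "x = y"
    proof (cases "x \<in> A")
      case True
      then have "h (u x) = h (u y)" "y \<in> A" using eq \<open>x \<in> A \<longleftrightarrow> y \<in> A\<close> by (auto simp: H_def)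
      then show ?thesis using True u inj_onD[OF h(2)] inj_onD[OF u(1)] by (metis image_subset_iff)
    next
      case False
      then have "r (v x) = r (v y)" "x \<in> B" "y \<in> B"
        using eq \<open>x \<in> A \<longleftrightarrow> y \<in> A\<close> x y by (auto simp: H_def)
      moreover have "v x \<in> A \<union> B" "v y \<in> A \<union> B" using calculation v by auto
      ultimately show ?thesis using inj_onD[OF v(1)] inj_onD[OF r_inj] by metis
    qed
  qed
  have disj: "H f p x \<noteq> H h q y" if "x \<in> A \<union> B" "y \<in> A \<union> B" for x y
  proof
    assume eq: "H f p x = H h q y"
    then have "x \<in> A \<longleftrightarrow> y \<in> A"
      using sep[OF _ f(3)] sep[OF _ h(3)] unfolding H_def by (metis (full_types))
    then show False
    proof (cases "x \<in> A")
      case True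
      then have "h (f x) = h (h y)" "y \<in> A" using eq \<open>x \<in> A \<longleftrightarrow> y \<in> A\<close> by (auto simp: H_def)
      then have "f x = h y" using True f(3) h(3) inj_onD[OF h(2)] by (metis image_subset_iff)
      then show False using True \<open>y \<in> A\<close> fh by blast
    next
      case False
      then have "r (p x) = r (q y)" "x \<in> B" "y \<in> B"
        using eq \<open>x \<in> A \<longleftrightarrow> y \<in> A\<close> that by (auto simp: H_def)
      moreover have "p x \<in> A \<union> B" "q y \<in> A \<union> B" using calculation p q by auto
      ultimately have "p x = q y" using inj_onD[OF r_inj] by metis
      then show False using \<open>x \<in> B\<close> \<open>y \<in> B\<close> pq by blast
    qed
  qed
  show ?thesis
    unfolding doubling_def
  proof (intro exI conjI)
    show "piecewise (A \<union> B) (H f p)" "piecewise (A \<union> B) (H h q)" using pw f h p q by auto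
    show "inj_on (H f p) (A \<union> B)" "inj_on (H h q) (A \<union> B)" using inj f h p q by auto
    show "H f p ` (A \<union> B) \<subseteq> A \<union> B" "H h q ` (A \<union> B) \<subseteq> A \<union> B" using img f h p q by auto
    show "H f p ` (A \<union> B) \<inter> H h q ` (A \<union> B) = {}" using disj by blast
  qed
qed

lemma doubling_UN:
  assumes "finite I" "\<And>i. i \<in> I \<Longrightarrow> doubling (E i)"
  shows "doubling (\<Union>i\<in>I. E i)"
  using assms
proof (induction I)
  case empty
  then show ?case by (simp add: doubling_def piecewise_def exI[of _ "{}"])
next
  case (insert i I)
  then show ?case by (simp add: doubling_Un)
qed

lemma act_inj: "g \<in> carrier G \<Longrightarrow> inj (\<phi> g)"
  by (rule inj_on_inverseI[of _ "\<phi> (inv g)"]) (metis act_mult act_one inv_closed l_inv)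

text \<open>The points of \<open>E\<close> are sorted by the least index of a group element that
  realises \<open>f\<close> there; injectivity of \<open>f\<close> keeps the images of these pieces
  disjoint.\<close>

lemma equidecomposable_image:
  assumes f: "piecewise E f" "inj_on f E" and "E \<noteq> {}"
  shows "equidecomposable G \<phi> (f ` E) E"
proof -
  obtain S where S: "finite S" "S \<subseteq> carrier G" "\<forall>x\<in>E. \<exists>g\<in>S. f x = \<phi> g x"
    using f unfolding piecewise_def by blast
  obtain g and m :: nat where g: "S = g ` {i. i < m}" using S(1) finite_imp_nat_seg_image_inj_on by metis
  define ix where "ix x = (LEAST i. i < m \<and> f x = \<phi> (g i) x)" for x
  have ix: "ix x < m \<and> f x = \<phi> (g (ix x)) x" if "x \<in> E" for x
  proof -
    have "\<exists>i. i < m \<and> f x = \<phi> (g i) x" using S(3) that unfolding g by auto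
    then show ?thesis unfolding ix_def by (rule LeastI_ex)
  qed
  define Q where "Q i = {x \<in> E. ix x = i}" for i
  show ?thesis
    unfolding equidecomposable_def
  proof (intro conjI exI)
    show "disjoint_family_on (\<lambda>i. f ` Q i) {..<m}"
      using f(2) unfolding disjoint_family_on_def Q_def inj_on_def by auto
    show "disjoint_family_on Q {..<m}" unfolding disjoint_family_on_def Q_def by auto
    show "(\<Union>i<m. Q i) = E" "(\<Union>i<m. f ` Q i) = f ` E" using ix unfolding Q_def by auto
    show "\<forall>i<m. g i \<in> carrier G \<and> f ` Q i = \<phi> (g i) ` Q i"
    proof (intro allI impI conjI)
      fix i assume "i < m"
      then show "g i \<in> carrier G" using S(2) g by auto
      show "f ` Q i = \<phi> (g i) ` Q i" using ix by (intro image_cong) (auto simp: Q_def)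
    qed
  qed (use assms in auto)
qed

lemma paradoxical_if_doubling: "doubling E \<Longrightarrow> E \<noteq> {} \<Longrightarrow> paradoxical G \<phi> E"
  unfolding doubling_def paradoxical_def using equidecomposable_image by metis

end

section \<open>Words acting on the real projective line\<close>

text \<open>The first component selects the generator, the second is \<open>True\<close> for the
  generator and \<open>False\<close> for its inverse. Words need not be reduced.\<close>

type_synonym letter = "bool \<times> bool"

definition linv :: "letter \<Rightarrow> letter" where "linv l = (fst l, \<not> snd l)"

definition winv :: "letter list \<Rightarrow> letter list" where "winv w = rev (map linv w)"

definition sgn2 :: "bool \<Rightarrow> int" where "sgn2 s = (if s then 2 else - 2)"

text \<open>The elementary matrices with off-diagonal entry 2 or -2. The projective line is
  represented by nonzero vectors up to scaling.\<close>

fun sanov_letter :: "letter \<Rightarrow> real \<times> real \<Rightarrow> real \<times> real" where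
  "sanov_letter (True, s) (x, y) = (x + real_of_int (sgn2 s) * y, y)"
| "sanov_letter (False, s) (x, y) = (x, y + real_of_int (sgn2 s) * x)"

fun sanov :: "letter list \<Rightarrow> real \<times> real \<Rightarrow> real \<times> real" where
  "sanov [] p = p"
| "sanov (l # w) p = sanov_letter l (sanov w p)"

lemma linv_linv [simp]: "linv (linv l) = l"
  by (simp add: linv_def)

lemma sanov_letter_linv [simp]: "sanov_letter (linv l) (sanov_letter l p) = p"
  "sanov_letter l (sanov_letter (linv l) p) = p"
  by (cases l; cases p; cases "fst l"; simp add: linv_def sgn2_def)+

lemma winv_winv [simp]: "winv (winv w) = w"
  by (simp add: winv_def rev_map comp_def)

lemma sanov_append: "sanov (v @ w) p = sanov v (sanov w p)"
  by (induction v) simp_all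

lemma sanov_winv [simp]: "sanov (winv w) (sanov w p) = p"
  by (induction w arbitrary: p) (simp_all add: winv_def sanov_append)

lemma sanov_letter_scaleR: "sanov_letter l (c *\<^sub>R p) = c *\<^sub>R sanov_letter l p"
  by (cases l; cases p; cases "fst l"; simp add: algebra_simps)

lemma sanov_scaleR: "sanov w (c *\<^sub>R p) = c *\<^sub>R sanov w p"
  by (induction w) (simp_all add: sanov_letter_scaleR)

lemma sanov_eq_0_iff [simp]: "sanov w p = 0 \<longleftrightarrow> p = 0"
  by (metis sanov_scaleR sanov_winv scaleR_zero_left)

text \<open>The matrices of \<open>sanov\<close> form Sanov's subgroup of \<open>SL\<^sub>2(\<int>)\<close>. Their traces are \<open>2\<close> modulo \<open>4\<close>,
  so none of them is elliptic.\<close>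

lemma sanov_matrix:
  obtains a b c d :: int where "sanov w = (\<lambda>(x :: real, y :: real). (a * x + b * y, c * x + d * y))"
    "a * d - b * c = 1" "a mod 4 = 1" "d mod 4 = 1" "even b" "even c"
proof (induction w arbitrary: thesis)
  case Nil
  show ?case by (rule Nil.prems[of 1 0 0 1]) auto
next
  case (Cons l w)
  obtain a b c d :: int where M: "sanov w = (\<lambda>(x :: real, y :: real). (a * x + b * y, c * x + d * y))"
    "a * d - b * c = 1" "a mod 4 = 1" "d mod 4 = 1" "even b" "even c"
    using Cons.IH by blast
  obtain s where s: "l = (True, s) \<or> l = (False, s)" by (cases l) auto
  obtain b' c' where bc: "b = 2 * b'" "c = 2 * c'" using M(5,6) by (elim evenE)
  have "sgn2 s = 2 \<or> sgn2 s = - 2" by (simp add: sgn2_def)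
  then have mods: "(a + sgn2 s * c) mod 4 = 1" "(d + sgn2 s * b) mod 4 = 1"
    "even (b + sgn2 s * d)" "even (c + sgn2 s * a)"
    using M(3-6) bc by (elim disjE; simp; presburger)+
  have dets: "(a + sgn2 s * c) * d - (b + sgn2 s * d) * c = 1"
    "a * (d + sgn2 s * b) - b * (c + sgn2 s * a) = 1"
    using M(2) by (simp_all add: algebra_simps)
  show ?case
    using s
  proof
    assume l: "l = (True, s)"
    show ?thesis
      by (rule Cons.prems[of "a + sgn2 s * c" "b + sgn2 s * d" c d])
        (use M mods dets in \<open>simp_all add: l fun_eq_iff algebra_simps\<close>)
  next
    assume l: "l = (False, s)"
    show ?thesis
      by (rule Cons.prems[of a b "c + sgn2 s * a" "d + sgn2 s * b"])
        (use M mods dets in \<open>simp_all add: l fun_eq_iff algebra_simps\<close>)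
  qed
qed

section \<open>Real eigenlines of Sanov's matrices\<close>

lemma parallel_if_kernel:
  fixes A B x y x' y' :: real
  assumes "A * x + B * y = 0" "A * x' + B * y' = 0" "A \<noteq> 0 \<or> B \<noteq> 0" "(x, y) \<noteq> 0"
  shows "\<exists>c. (x', y') = c *\<^sub>R (x, y)"
proof -
  \<comment> \<open>As in Cramer's rule, both coefficients annihilate the determinant of the two
    vectors.\<close>
  have "A * (x * y' - x' * y) = y' * (A * x + B * y) - y * (A * x' + B * y')"
    "B * (x * y' - x' * y) = x * (A * x' + B * y') - x' * (A * x + B * y)"
    by (simp_all add: algebra_simps)
  then have eq: "x * y' = x' * y" using assms by auto
  show ?thesis
  proof (cases "x = 0")
    case True
    then show ?thesis using eq assms by (intro exI[of _ "y' / y"]) (auto simp: zero_prod_def)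
  next
    case False
    then show ?thesis using eq by (intro exI[of _ "x' / x"]) (auto simp: field_simps)
  qed
qed

text \<open>The trace is 2 modulo 4, so its absolute value is at least 2 and the eigenvalues are
  real. A Sanov matrix other than the identity is not scalar, so its eigenspaces are lines.\<close>

lemma sanov_eigenvector:
  assumes "sanov w \<noteq> id"
  obtains p \<mu> where "p \<noteq> 0" "sanov w p = \<mu> *\<^sub>R p"
    "\<And>q. sanov w q = \<mu> *\<^sub>R q \<Longrightarrow> \<exists>c. q = c *\<^sub>R p"
proof -
  obtain a b c d :: int where M: "sanov w = (\<lambda>(x :: real, y :: real). (a * x + b * y, c * x + d * y))"
    "a * d - b * c = 1" "a mod 4 = 1" "d mod 4 = 1"
    by (rule sanov_matrix[of w]) (rule that)
  \<comment> \<open>A diagonal integer matrix of determinant 1 is plus or minus the identity, and -1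
    is not 1 modulo 4.\<close>
  have bc: "b \<noteq> 0 \<or> c \<noteq> 0"
  proof (rule ccontr)
    assume "\<not> ?thesis"
    then have b: "b = 0" "c = 0" by auto
    then have "a * d = 1" using M by simp
    then have "a = 1 \<and> d = 1 \<or> a = - 1 \<and> d = - 1" by (rule zmult_eq_1_iff[THEN iffD1])
    then have "a = 1 \<and> d = 1" using M(3) by auto
    then show False using assms M(1) b by (auto simp: fun_eq_iff)
  qed
  define t where "t = real_of_int (a + d)"
  have "(a + d) mod 4 = 2" using M(3,4) by presburger
  then have "a + d \<ge> 2 \<or> a + d \<le> - 2" by presburger
  then have "t \<ge> 2 \<or> t \<le> - 2" unfolding t_def by linarith
  then have "\<bar>2\<bar> \<le> \<bar>t\<bar>" by linarith
  then have t: "t\<^sup>2 - 4 \<ge> 0" using abs_le_square_iff[of 2 t] by simp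
  \<comment> \<open>The larger root of the characteristic polynomial.\<close>
  define \<mu> where "\<mu> = (t + sqrt (t\<^sup>2 - 4)) / 2"
  have "2 * \<mu> - t = sqrt (t\<^sup>2 - 4)" by (simp add: \<mu>_def field_simps)
  then have "(2 * \<mu> - t)\<^sup>2 = t\<^sup>2 - 4" using t by simp
  then have \<mu>: "\<mu> * \<mu> - t * \<mu> + 1 = 0" by (simp add: power2_eq_square algebra_simps)
  have det: "real_of_int a * d - b * c = 1" using M(2) by (metis of_int_1 of_int_diff of_int_mult)
  have char: "(a - \<mu>) * (d - \<mu>) = b * c"
    using \<mu> det by (simp add: t_def algebra_simps)
  \<comment> \<open>The kernel vector of whichever row of the matrix minus \<mu> has a nonzero
    off-diagonal entry.\<close>
  define p where "p = (if b \<noteq> 0 then (real_of_int b, \<mu> - a) else (\<mu> - d, real_of_int c))"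
  have p0: "p \<noteq> 0" using bc by (auto simp: p_def zero_prod_def)
  have pe: "sanov w p = \<mu> *\<^sub>R p"
    using char by (auto simp: M(1) p_def algebra_simps)
  show thesis
  proof (rule that[OF p0 pe])
    fix q assume q: "sanov w q = \<mu> *\<^sub>R q"
    obtain x y x' y' where xy: "p = (x, y)" "q = (x', y')" by (cases p; cases q)
    show "\<exists>c. q = c *\<^sub>R p"
    proof (cases "b = 0")
      case False
      then show ?thesis
        unfolding xy by (intro parallel_if_kernel[of "a - \<mu>" x b y])
          (use pe q p0 in \<open>auto simp: M(1) xy algebra_simps\<close>)
    next
      case True
      then show ?thesis
        unfolding xy by (intro parallel_if_kernel[of c x "d - \<mu>" y])
          (use pe q p0 bc in \<open>auto simp: M(1) xy algebra_simps\<close>)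
    qed
  qed
qed

text \<open>A map commuting with \<open>sanov v\<close> preserves its eigenspaces. For a nonidentity
  \<open>sanov v\<close> the chosen eigenspace is a line, so every member of \<open>S\<close> scales
  it.\<close>

lemma common_eigenvector:
  assumes "\<And>v w. v \<in> S \<Longrightarrow> w \<in> S \<Longrightarrow> sanov v \<circ> sanov w = sanov w \<circ> sanov v"
  shows "\<exists>p. p \<noteq> 0 \<and> (\<forall>w\<in>S. \<exists>c. sanov w p = c *\<^sub>R p)"
proof (cases "\<forall>w\<in>S. sanov w = id")
  case True
  then show ?thesis by (intro exI[of _ "(1, 0)"]) (auto simp: zero_prod_def intro: exI[of _ 1])
next
  case False
  then obtain v where v: "v \<in> S" "sanov v \<noteq> id" by blast
  obtain p \<mu> where p: "p \<noteq> 0" "sanov v p = \<mu> *\<^sub>R p"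
    "\<And>q. sanov v q = \<mu> *\<^sub>R q \<Longrightarrow> \<exists>c. q = c *\<^sub>R p"
    using sanov_eigenvector[OF v(2)] by blast
  have "\<exists>c. sanov w p = c *\<^sub>R p" if w: "w \<in> S" for w
  proof (rule p(3))
    have "sanov v (sanov w p) = sanov w (sanov v p)" using assms[OF v(1) w] by (metis comp_apply)
    then show "sanov v (sanov w p) = \<mu> *\<^sub>R sanov w p" by (simp add: p(2) sanov_scaleR)
  qed
  then show ?thesis using p(1) by blast
qed

section \<open>Paradoxical decompositions from equivariant directions\<close>

text \<open>In the coordinate t = x/y these are the arcs [1, infinity], t < -1, 0 <= t < 1 and -1 <=
  t < 0. They partition the projective line, the point y = 0 belonging to the first.\<close>

fun region :: "letter \<Rightarrow> real \<times> real \<Rightarrow> bool" where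
  "region (True, True) (x, y) \<longleftrightarrow> y * y \<le> x * y"
| "region (True, False) (x, y) \<longleftrightarrow> x * y < - (y * y)"
| "region (False, True) (x, y) \<longleftrightarrow> 0 \<le> x * y \<and> x * y < y * y"
| "region (False, False) (x, y) \<longleftrightarrow> - (y * y) \<le> x * y \<and> x * y < 0"

lemma region_disjoint: "region l p \<Longrightarrow> region l' p \<Longrightarrow> l = l'"
proof -
  obtain x y where p: "p = (x, y)" by (cases p)
  have "\<not> (y * y \<le> x * y \<and> x * y < - (y * y))" using zero_le_square[of y] by linarith
  then show "region l p \<Longrightarrow> region l' p \<Longrightarrow> l = l'"
    unfolding p by (cases "(l, p)" rule: region.cases; cases "(l', p)" rule: region.cases) (auto simp: p)
qed

text \<open>Ping-pong: t -> t + 2 carries the complement of t < -1 exactly onto [1, infinity], and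
  1/t -> 1/t + 2 carries the complement of [-1, 0) exactly onto [0, 1). The half-open endpoints make
  this an equivalence.\<close>

lemma region_sanov_letter:
  assumes "p \<noteq> 0"
  shows "region (k, True) (sanov_letter (k, True) p) \<longleftrightarrow> \<not> region (k, False) p"
proof -
  obtain x y where p: "p = (x, y)" by (cases p)
  have nz: "x \<noteq> 0 \<or> y \<noteq> 0" using assms by (auto simp: p zero_prod_def)
  show ?thesis
  proof (cases k)
    case True
    then show ?thesis by (auto simp: p sgn2_def algebra_simps)
  next
    case False
    have "(0 \<le> x * (y + 2 * x) \<and> x * (y + 2 * x) < (y + 2 * x) * (y + 2 * x))
        \<longleftrightarrow> \<not> (- (y * y) \<le> x * y \<and> x * y < 0)"
    proof -
      \<comment> \<open>Both comparisons become signs of products of linear forms, which the cases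
        on the sign of \<open>y\<close> decide.\<close>
      have 1: "x * (y + 2 * x) < (y + 2 * x) * (y + 2 * x) \<longleftrightarrow> 0 < (x + y) * (y + 2 * x)"
        and 2: "- (y * y) \<le> x * y \<longleftrightarrow> 0 \<le> (x + y) * y"
        by (auto simp add: algebra_simps)
      consider "y > 0" | "y < 0" | "y = 0" by linarith
      then show ?thesis
        unfolding 1 2 using nz
        by cases (auto simp: zero_le_mult_iff zero_less_mult_iff mult_less_0_iff)
    qed
    then show ?thesis using False by (simp add: p sgn2_def)
  qed
qed

text \<open>All conditions compare quadratic forms, which scale by \<open>c * c > 0\<close>; hence
  \<open>region\<close> depends only on the line.\<close>

lemma region_scaleR:
  assumes "c \<noteq> 0"
  shows "region l (c *\<^sub>R p) \<longleftrightarrow> region l p"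
proof -
  obtain x y where p: "p = (x, y)" by (cases p)
  have c: "c * c > 0" using assms by (simp add: zero_less_mult_iff linorder_neq_iff disj_commute)
  have "(c * y * (c * y) \<le> c * x * (c * y)) = (c * c * (y * y) \<le> c * c * (x * y))"
    "(c * x * (c * y) < - (c * y * (c * y))) = (c * c * (x * y) < c * c * (- (y * y)))"
    "(- (c * y * (c * y)) \<le> c * x * (c * y)) = (c * c * (- (y * y)) \<le> c * c * (x * y))"
    "(c * x * (c * y) < c * y * (c * y)) = (c * c * (x * y) < c * c * (y * y))"
    by (simp_all add: algebra_simps)
  moreover have "(c * x * (c * y) < 0) = (x * y < 0)" "(0 \<le> c * x * (c * y)) = (0 \<le> x * y)"
    using c mult_less_cancel_left_pos[OF c, of "x * y" 0] mult_le_cancel_left_pos[OF c, of 0 "x * y"]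
    by (simp_all add: algebra_simps)
  ultimately show ?thesis
    using c unfolding p
    by (cases "(l, p)" rule: region.cases)
      (simp_all add: mult_le_cancel_left_pos mult_less_cancel_left_pos del: mult_minus_right)
qed

text \<open>Words act on \<open>E\<close> and, through \<open>sanov\<close>, on the plane.
  \<open>stabilizer_commute\<close> takes the place of freeness: words fixing a common point need
  only commute as Sanov matrices.\<close>

locale word_action =
  fixes act :: "letter list \<Rightarrow> 'x \<Rightarrow> 'x" and E :: "'x set"
  assumes act_Nil: "act [] x = x"
    and act_append: "act (v @ w) x = act v (act w x)"
    and act_cancel: "act [linv l, l] x = x"
    and act_mem: "x \<in> E \<Longrightarrow> act w x \<in> E"
    and stabilizer_commute: "x \<in> E \<Longrightarrow> act v x = x \<Longrightarrow> act w x = x \<Longrightarrow>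
      sanov v \<circ> sanov w = sanov w \<circ> sanov v"
begin

lemma act_winv [simp]: "act (winv w) (act w x) = x"
proof (induction w arbitrary: x)
  case Nil
  then show ?case by (simp add: winv_def act_Nil)
next
  case (Cons l w)
  have "act (winv (l # w)) (act (l # w) x) = act (winv w) (act [linv l] (act [l] (act w x)))"
    using act_append[of "[l]" w] by (simp add: winv_def act_append)
  also have "\<dots> = act (winv w) (act w x)"
    using act_append[of "[linv l]" "[l]"] by (simp add: act_cancel)
  finally show ?case by (simp add: Cons.IH)
qed

definition orbit :: "'x \<Rightarrow> 'x set" where "orbit x = range (\<lambda>w. act w x)"

lemma orbit_act [simp]: "orbit (act v x) = orbit x"
proof -
  have "act w (act v x) = act (w @ v) x" "act w x = act (w @ winv v) (act v x)" for w
    by (simp_all add: act_append)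
  then show ?thesis unfolding orbit_def by (metis (no_types, lifting) image_subset_iff rangeI subset_antisym)
qed

text \<open>The choice depends on \<open>x\<close> only through its orbit, so it is constant along
  orbits.\<close>

definition base :: "'x \<Rightarrow> 'x" where "base x = (SOME y. y \<in> orbit x)"

lemma base_act [simp]: "base (act v x) = base x"
  by (simp add: base_def)

lemma base_in_orbit: obtains w where "base x = act w x"
proof -
  have "base x \<in> orbit x" unfolding base_def by (rule someI[of _ x]) (metis act_Nil orbit_def rangeI)
  then show thesis using that by (auto simp: orbit_def)
qed

text \<open>In each orbit a common eigenline of the stabilizer of the base point is transported
  along words. Two words from the base point to the same point differ by a stabilizing word, which
  only rescales the vector.\<close>

lemma equivariant_direction:
  obtains \<xi> where "\<And>x. x \<in> E \<Longrightarrow> \<xi> x \<noteq> 0"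
    "\<And>x l. x \<in> E \<Longrightarrow> \<exists>c. c \<noteq> 0 \<and> \<xi> (act [l] x) = c *\<^sub>R sanov_letter l (\<xi> x)"
proof -
  define stab where "stab x = {w. act w x = x}" for x
  define p where "p x = (SOME p. p \<noteq> 0 \<and> (\<forall>w\<in>stab x. \<exists>c. sanov w p = c *\<^sub>R p))" for x
  have p: "p x \<noteq> 0" "\<And>w. act w x = x \<Longrightarrow> \<exists>c. sanov w (p x) = c *\<^sub>R p x" if x: "x \<in> E" for x
  proof -
    have "\<exists>p. p \<noteq> 0 \<and> (\<forall>w\<in>stab x. \<exists>c. sanov w p = c *\<^sub>R p)"
      by (rule common_eigenvector) (use x in \<open>auto simp: stab_def intro: stabilizer_commute\<close>)
    then have "p x \<noteq> 0 \<and> (\<forall>w\<in>stab x. \<exists>c. sanov w (p x) = c *\<^sub>R p x)"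
      unfolding p_def by (rule someI_ex)
    then show "p x \<noteq> 0" "\<And>w. act w x = x \<Longrightarrow> \<exists>c. sanov w (p x) = c *\<^sub>R p x"
      by (auto simp: stab_def)
  qed
  define word where "word x = (SOME w. act w (base x) = x)" for x
  have word: "act (word x) (base x) = x" for x
  proof -
    obtain w where "base x = act w x" by (rule base_in_orbit)
    then have "act (winv w) (base x) = x" by simp
    then show ?thesis unfolding word_def by (rule someI)
  qed
  define \<xi> where "\<xi> x = sanov (word x) (p (base x))" for x
  have base: "base x \<in> E" if "x \<in> E" for x
    using base_in_orbit[of x] act_mem[OF that] by metis
  show thesis
  proof (rule that[of \<xi>])
    show nz: "\<xi> x \<noteq> 0" if "x \<in> E" for x using p(1)[OF base[OF that]] by (simp add: \<xi>_def)
    fix x l assume x: "x \<in> E"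
    define b where "b = base x"
    define v where "v = word (act [l] x)"
    define w where "w = l # word x"
    have "act v b = act w b"
      using word[of "act [l] x"] word[of x] act_append[of "[l]" "word x" b]
      by (simp add: v_def w_def b_def)
    \<comment> \<open>\<open>v\<close> and \<open>w\<close> both lead from the base point to
      \<open>act [l] x\<close>, so going along \<open>v\<close> and back along \<open>w\<close> is a
      loop at \<open>b\<close>.\<close>
    then have "act (winv w @ v) b = b" by (simp add: act_append)
    then obtain c where "sanov (winv w @ v) (p b) = c *\<^sub>R p b"
      using p(2)[OF base[OF x]] unfolding b_def by blast
    then have "sanov (winv w) (sanov v (p b)) = sanov (winv w) (sanov w (c *\<^sub>R p b))"
      by (simp add: sanov_append)
    then have "sanov v (p b) = sanov w (c *\<^sub>R p b)"
      by (metis sanov_winv sanov_append append_Nil2 winv_winv)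
    then have eq: "\<xi> (act [l] x) = c *\<^sub>R sanov_letter l (\<xi> x)"
      by (simp add: \<xi>_def v_def w_def b_def sanov_scaleR sanov_letter_scaleR)
    moreover have "c \<noteq> 0" using eq nz[OF act_mem[OF x, of "[l]"]] by auto
    ultimately show "\<exists>c. c \<noteq> 0 \<and> \<xi> (act [l] x) = c *\<^sub>R sanov_letter l (\<xi> x)" by blast
  qed
qed

text \<open>The pieces are the preimages of the four arcs under the equivariant direction, so
  ping-pong on the projective line carries over to \<open>E\<close>.\<close>

lemma four_pieces:
  obtains X where "\<And>l. X l \<subseteq> E" "\<And>l l'. l \<noteq> l' \<Longrightarrow> X l \<inter> X l' = {}"
    "\<And>k. act [(k, True)] ` (E - X (k, False)) = X (k, True)"
proof -
  obtain \<xi> where \<xi>: "\<And>x. x \<in> E \<Longrightarrow> \<xi> x \<noteq> 0"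
    "\<And>x l. x \<in> E \<Longrightarrow> \<exists>c. c \<noteq> 0 \<and> \<xi> (act [l] x) = c *\<^sub>R sanov_letter l (\<xi> x)"
    by (rule equivariant_direction) (rule that)
  define X where "X l = {x \<in> E. region l (\<xi> x)}" for l
  have step: "act [(k, True)] x \<in> X (k, True) \<longleftrightarrow> x \<notin> X (k, False)" if x: "x \<in> E" for x k
  proof -
    obtain c where "c \<noteq> 0" "\<xi> (act [(k, True)] x) = c *\<^sub>R sanov_letter (k, True) (\<xi> x)" using \<xi>(2)[OF x] by blast
    then show ?thesis
      using x \<xi>(1)[OF x] act_mem[OF x] by (simp add: X_def region_scaleR region_sanov_letter)
  qed
  show thesis
  proof (rule that[of X])
    show "X l \<subseteq> E" for l by (auto simp: X_def)
    show "X l \<inter> X l' = {}" if "l \<noteq> l'" for l l'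
      using that region_disjoint[of l _ l'] unfolding X_def by blast
    show "act [(k, True)] ` (E - X (k, False)) = X (k, True)" for k
    proof (intro subset_antisym subsetI)
      fix x assume "x \<in> act [(k, True)] ` (E - X (k, False))"
      then show "x \<in> X (k, True)" using step by auto
    next
      fix x assume x: "x \<in> X (k, True)"
      then have xE: "x \<in> E" by (simp add: X_def)
      define y where "y = act [(k, False)] x"
      have "x = act [(k, True)] y"
        using act_cancel[of "(k, False)" x] act_append[of "[(k, True)]" "[(k, False)]" x]
        by (simp add: y_def linv_def)
      moreover have "y \<in> E" unfolding y_def by (rule act_mem[OF xE])
      ultimately show "x \<in> act [(k, True)] ` (E - X (k, False))" using step x by auto
    qed
  qed
qed

end

section \<open>Words in the unit quaternions\<close>

lemma quat_sel [simp]: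
  "qRe 0 = 0" "qI 0 = 0" "qJ 0 = 0" "qK 0 = 0"
  "qRe 1 = 1" "qI 1 = 0" "qJ 1 = 0" "qK 1 = 0"
  "qRe (x + y) = qRe x + qRe y" "qI (x + y) = qI x + qI y"
  "qJ (x + y) = qJ x + qJ y" "qK (x + y) = qK x + qK y"
  "qRe (x - y) = qRe x - qRe y" "qI (x - y) = qI x - qI y"
  "qJ (x - y) = qJ x - qJ y" "qK (x - y) = qK x - qK y"
  "qRe (- x) = - qRe x" "qI (- x) = - qI x" "qJ (- x) = - qJ x" "qK (- x) = - qK x"
  "qRe (r *\<^sub>R x) = r * qRe x" "qI (r *\<^sub>R x) = r * qI x"
  "qJ (r *\<^sub>R x) = r * qJ x" "qK (r *\<^sub>R x) = r * qK x"
  "qRe (x * y) = qRe x * qRe y - qI x * qI y - qJ x * qJ y - qK x * qK y"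
  "qI (x * y) = qRe x * qI y + qI x * qRe y + qJ x * qK y - qK x * qJ y"
  "qJ (x * y) = qRe x * qJ y - qI x * qK y + qJ x * qRe y + qK x * qI y"
  "qK (x * y) = qRe x * qK y + qI x * qJ y - qJ x * qI y + qK x * qRe y"
  "qRe (conjK x) = qRe x" "qI (conjK x) = - qI x" "qJ (conjK x) = - qJ x" "qK (conjK x) = - qK x"
  by (simp_all add: quat_defs conjK_quat_def)

definition qnorm2 :: "quat \<Rightarrow> real" where
  "qnorm2 x = qRe x * qRe x + qI x * qI x + qJ x * qJ x + qK x * qK x"

lemma qnorm2_mult: "qnorm2 (x * y) = qnorm2 x * qnorm2 y"
  by (simp add: qnorm2_def algebra_simps)

lemma qnorm2_one [simp]: "qnorm2 1 = 1"
  by (simp add: qnorm2_def)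

lemma qnorm2_conjK [simp]: "qnorm2 (conjK x) = qnorm2 x"
  by (simp add: qnorm2_def)

lemma conjK_mult_self: "conjK x * x = qnorm2 x *\<^sub>R 1" "x * conjK x = qnorm2 x *\<^sub>R (1 :: quat)"
  by (simp_all add: quat_eq_iff qnorm2_def)

section \<open>Integer quaternions modulo 5\<close>

definition Lipschitz :: "quat set" where
  "Lipschitz = {x. qRe x \<in> \<int> \<and> qI x \<in> \<int> \<and> qJ x \<in> \<int> \<and> qK x \<in> \<int>}"

text \<open>The integer quaternions that vanish modulo 5; quotients are avoided by testing
  membership here.\<close>

definition Lipschitz5 :: "quat set" where "Lipschitz5 = (\<lambda>x. 5 *\<^sub>R x) ` Lipschitz"

lemma Lipschitz_closed:
  "x \<in> Lipschitz \<Longrightarrow> y \<in> Lipschitz \<Longrightarrow> x * y \<in> Lipschitz" "x \<in> Lipschitz \<Longrightarrow> y \<in> Lipschitz \<Longrightarrow> x - y \<in> Lipschitz"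
  by (simp_all add: Lipschitz_def)

lemma Lipschitz5_closed:
  "x \<in> Lipschitz \<Longrightarrow> y \<in> Lipschitz5 \<Longrightarrow> x * y \<in> Lipschitz5" "x \<in> Lipschitz5 \<Longrightarrow> y \<in> Lipschitz5 \<Longrightarrow> x - y \<in> Lipschitz5"
  unfolding Lipschitz5_def by (auto simp: Lipschitz_closed simp flip: scaleR_right_diff_distrib)

text \<open>The unit letters cleared of the denominator \<open>sqrt 5\<close>: integer quaternions
  of norm 5.\<close>

definition int_letter :: "letter \<Rightarrow> quat" where
  "int_letter l = (if fst l then Quat 1 (of_int (sgn2 (snd l))) 0 0 else Quat 1 0 (of_int (sgn2 (snd l))) 0)"

fun int_word :: "letter list \<Rightarrow> quat" where
  "int_word [] = 1"
| "int_word (l # w) = int_letter l * int_word w"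

fun reduced :: "letter list \<Rightarrow> bool" where
  "reduced (l # l' # w) \<longleftrightarrow> l \<noteq> linv l' \<and> reduced (l' # w)"
| "reduced _ \<longleftrightarrow> True"

lemma int_letter_Lipschitz [simp]: "int_letter l \<in> Lipschitz"
  by (simp add: int_letter_def Lipschitz_def)

lemma int_letter_linv: "int_letter (linv l) = conjK (int_letter l)"
  by (simp add: int_letter_def linv_def sgn2_def quat_eq_iff)

lemma qnorm2_int_letter [simp]: "qnorm2 (int_letter l) = 5"
  by (simp add: int_letter_def qnorm2_def sgn2_def)

lemma int_word_Lipschitz: "int_word w \<in> Lipschitz"
  by (induction w) (simp_all add: Lipschitz_closed, simp add: Lipschitz_def)

lemma conjK_Lipschitz [simp]: "conjK x \<in> Lipschitz \<longleftrightarrow> x \<in> Lipschitz"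
  by (simp add: Lipschitz_def)

text \<open>Modulo \<open>5\<close> the letters are zero divisors: \<open>y\<close> lies in the right ideal of the letter \<open>l\<close> iff the
  conjugate letter kills it. Only the zero class lies in the kernels of two distinct letters, since the
  difference of two letters has norm \<open>8\<close> or \<open>16\<close>.\<close>

lemma int_letter_kernels:
  assumes "l \<noteq> l'" "y \<in> Lipschitz" "int_letter l * y \<in> Lipschitz5" "int_letter l' * y \<in> Lipschitz5"
  shows "y \<in> Lipschitz5"
proof -
  define d where "d = int_letter l - int_letter l'"
  have "qnorm2 d = 8 \<or> qnorm2 d = 16"
    using assms(1) by (cases l; cases l') (auto simp: d_def int_letter_def qnorm2_def sgn2_def)
  \<comment> \<open>Since 16 is 1 modulo 5, \<open>k\<close> is a left inverse of \<open>d\<close>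
    modulo 5.\<close>
  then obtain k where k: "k \<in> Lipschitz" "k * d = 16 *\<^sub>R 1"
  proof
    assume "qnorm2 d = 8"
    then have "(2 *\<^sub>R conjK d) * d = 16 *\<^sub>R 1" by (simp add: conjK_mult_self)
    moreover have "2 *\<^sub>R conjK d \<in> Lipschitz" by (simp add: d_def Lipschitz_def int_letter_def)
    ultimately show thesis by (rule that[rotated])
  next
    assume "qnorm2 d = 16"
    then have "conjK d * d = 16 *\<^sub>R 1" by (simp add: conjK_mult_self)
    moreover have "conjK d \<in> Lipschitz" by (simp add: d_def Lipschitz_closed)
    ultimately show thesis by (rule that[rotated])
  qed
  have "d * y \<in> Lipschitz5" using assms Lipschitz5_closed by (simp add: d_def left_diff_distrib)
  then have "(k * d) * y \<in> Lipschitz5" unfolding mult.assoc by (rule Lipschitz5_closed(1)[OF k(1)])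
  then have "16 *\<^sub>R y \<in> Lipschitz5" by (simp add: k)
  moreover have "15 *\<^sub>R y \<in> Lipschitz5"
    unfolding Lipschitz5_def using assms(2) by (intro image_eqI[of _ _ "3 *\<^sub>R y"]) (simp_all add: Lipschitz_def)
  ultimately have "16 *\<^sub>R y - 15 *\<^sub>R y \<in> Lipschitz5" by (rule Lipschitz5_closed)
  then show ?thesis by (simp flip: scaleR_left_diff_distrib)
qed

text \<open>The second conjunct carries the induction: if prepending \<open>l\<close> gave zero
  modulo 5, the old word would lie in the kernels of \<open>l\<close> and of the inverse of its
  first letter. These differ in a reduced word, so the old word would vanish already.\<close>

lemma reduced_int_word:
  assumes "reduced (l # w)"
  shows "int_word (l # w) \<notin> Lipschitz5 \<and> int_letter (linv l) * int_word (l # w) \<in> Lipschitz5"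
  using assms
proof (induction w arbitrary: l)
  case Nil
  have "int_letter l \<notin> Lipschitz5"
  proof
    assume "int_letter l \<in> Lipschitz5"
    \<comment> \<open>The real part of a letter is 1, which is not a multiple of 5.\<close>
    then have "1 = 5 * qRe x \<and> qRe x \<in> \<int>" if "int_letter l = 5 *\<^sub>R x" "x \<in> Lipschitz" for x
      using arg_cong[OF that(1), of qRe] that(2) by (simp add: int_letter_def Lipschitz_def split: if_splits)
    with \<open>int_letter l \<in> Lipschitz5\<close> obtain r :: real where r: "1 = 5 * r" "r \<in> \<int>" unfolding Lipschitz5_def by blast
    then obtain k :: int where "r = of_int k" by (elim Ints_cases)
    with r have "real_of_int (5 * k) = real_of_int 1" by simp
    then show False by (simp only: of_int_eq_iff) presburger
  qed
  moreover have "int_letter (linv l) * int_letter l \<in> Lipschitz5"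
    unfolding int_letter_linv conjK_mult_self Lipschitz5_def qnorm2_int_letter by (intro imageI) (simp add: Lipschitz_def)
  ultimately show ?case by simp
next
  case (Cons m w)
  define y where "y = int_word (m # w)"
  have red: "l \<noteq> linv m" "reduced (m # w)" using Cons.prems by auto
  have y: "y \<notin> Lipschitz5" "int_letter (linv m) * y \<in> Lipschitz5" "y \<in> Lipschitz"
    using Cons.IH[OF red(2)] int_word_Lipschitz[of "m # w"] unfolding y_def by blast+
  have "int_letter l * y \<notin> Lipschitz5"
    using int_letter_kernels[OF red(1) y(3) _ y(2)] y(1) by blast
  moreover have "int_letter (linv l) * (int_letter l * y) = 5 *\<^sub>R y"
    by (simp add: int_letter_linv conjK_mult_self flip: mult.assoc)
  then have "int_letter (linv l) * (int_letter l * y) \<in> Lipschitz5" using y(3) by (simp add: Lipschitz5_def)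
  ultimately show ?case by (simp add: y_def)
qed

section \<open>Relations among unit quaternion words\<close>

fun unit_word :: "letter list \<Rightarrow> quat" where
  "unit_word [] = 1"
| "unit_word (l # w) = (1 / sqrt 5) *\<^sub>R int_letter l * unit_word w"

lemma unit_word_append: "unit_word (v @ w) = unit_word v * unit_word w"
  by (induction v) (simp_all add: mult.assoc)

lemma unit_word_int_word: "int_word w = sqrt 5 ^ length w *\<^sub>R unit_word w"
  by (induction w) simp_all

lemma qnorm2_unit_word [simp]: "qnorm2 (unit_word w) = 1"
proof (induction w)
  case (Cons l w)
  have "qnorm2 ((1 / sqrt 5) *\<^sub>R int_letter l) = (1 / sqrt 5) * (1 / sqrt 5) * qnorm2 (int_letter l)"
    by (simp only: qnorm2_def quat_sel) (simp add: algebra_simps)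
  then have "qnorm2 ((1 / sqrt 5) *\<^sub>R int_letter l) = 1" by simp
  then show ?case by (simp only: unit_word.simps qnorm2_mult Cons mult_1)
qed simp

lemma unit_word_cancel: "unit_word [linv l, l] = 1" "unit_word [l, linv l] = 1"
  by (simp_all add: int_letter_linv conjK_mult_self)

lemma unit_word_winv: "unit_word (winv w) * unit_word w = 1"
proof (induction w)
  case (Cons l w)
  have "unit_word (winv (l # w)) * unit_word (l # w) = unit_word (winv w) * unit_word [linv l, l] * unit_word w"
    by (simp add: winv_def unit_word_append mult.assoc)
  then show ?case by (simp add: unit_word_cancel Cons del: unit_word.simps)
qed (simp add: winv_def)

text \<open>Deleting a cancelling pair changes neither the quaternion nor the matrix. Keeping both
  with one reduced word lets relations pass from the quaternions to the matrices.\<close>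

lemma reduced_form:
  obtains w' where "reduced w'" "unit_word w' = unit_word w" "sanov w' = sanov w"
proof (induction w arbitrary: thesis)
  case Nil
  show ?case by (rule Nil[of "[]"]) simp_all
next
  case (Cons l w)
  obtain v where v: "reduced v" "unit_word v = unit_word w" "sanov v = sanov w" by (rule Cons.IH)
  show ?case
  proof (cases "v \<noteq> [] \<and> l = linv (hd v)")
    case True
    then obtain m u where mu: "v = m # u" "l = linv m" by (cases v) auto
    have "unit_word (l # w) = unit_word (l # v)" by (simp only: unit_word.simps v(2))
    also have "\<dots> = unit_word ([linv m, m] @ u)" by (simp add: mu)
    also have "\<dots> = unit_word u" by (simp only: unit_word_append unit_word_cancel mult_1_left)
    finally have "unit_word u = unit_word (l # w)" by simp
    moreover have "sanov u = sanov (l # w)" using v(3) by (simp add: mu fun_eq_iff flip: v(3))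
    moreover have "reduced u" using v(1) by (cases u) (simp_all add: mu)
    ultimately show ?thesis by (rule Cons.prems[rotated])
  next
    case False
    then have "reduced (l # v)" using v(1) by (cases v) auto
    then show ?thesis by (rule Cons.prems) (simp_all add: v fun_eq_iff)
  qed
qed

text \<open>For a nonempty reduced word of value 1, the integer word is the real number
  \<open>sqrt 5 ^ length v\<close>. It is then an integer whose square is divisible by 5, so it is
  itself divisible by 5, against \<open>reduced_int_word\<close>.\<close>

lemma sanov_eq_id_if_unit_word:
  assumes "unit_word w = 1"
  shows "sanov w = id"
proof -
  obtain v where v: "reduced v" "unit_word v = unit_word w" "sanov v = sanov w" by (rule reduced_form)
  show ?thesis
  proof (cases v)
    case Nil
    then show ?thesis using v(3) by (simp add: fun_eq_iff)
  next
    case (Cons l u)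
    define r where "r = sqrt 5 ^ length v"
    have N: "int_word v = r *\<^sub>R 1" using unit_word_int_word[of v] v(2) assms by (simp add: r_def)
    then have "r \<in> \<int>" using int_word_Lipschitz[of v] by (simp add: Lipschitz_def)
    then obtain k :: int where k: "r = of_int k" by (elim Ints_cases)
    have "r * r = 5 * 5 ^ length u"
      by (simp add: r_def Cons algebra_simps flip: power_mult_distrib)
    then have "real_of_int (k * k) = real_of_int (5 * 5 ^ length u)" by (simp add: k)
    then have "k * k = 5 * 5 ^ length u" by (simp only: of_int_eq_iff)
    then have "5 dvd k * k" by simp
    then have "(k mod 5) * (k mod 5) mod 5 = 0" by (simp add: mod_mult_eq)
    moreover have "k mod 5 \<in> {0, 1, 2, 3, 4}" by auto
    ultimately have "5 dvd k" by auto
    then obtain j where "k = 5 * j" by (elim dvdE)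
    then have "int_word v = 5 *\<^sub>R (of_int j *\<^sub>R 1)" using N k by simp
    then have "int_word v \<in> Lipschitz5" unfolding Lipschitz5_def by (rule image_eqI) (simp add: Lipschitz_def)
    then show ?thesis using reduced_int_word v(1) Cons by blast
  qed
qed

lemma sanov_commute_if_unit_word_commute:
  assumes "unit_word v * unit_word w = unit_word w * unit_word v"
  shows "sanov v \<circ> sanov w = sanov w \<circ> sanov v"
proof -
  \<comment> \<open>The commutator word is trivial as a quaternion, hence trivial as a
    matrix.\<close>
  have "unit_word (winv (w @ v) @ v @ w) = 1"
    using assms unit_word_winv[of "w @ v"] by (simp add: unit_word_append)
  then have "sanov (winv (w @ v) @ v @ w) = id" by (rule sanov_eq_id_if_unit_word)
  then have "sanov (winv (w @ v)) (sanov (v @ w) p) = p" for p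
    by (metis sanov_append id_apply)
  then have "sanov (v @ w) p = sanov (w @ v) p" for p by (metis sanov_winv winv_winv)
  then show ?thesis by (simp add: fun_eq_iff sanov_append)
qed

text \<open>Every letter is 1 modulo 2. The odd real part is what keeps words away from real part 0,
  where \<open>lie_if_stabilizer\<close> could not divide by
  \<open>\<kappa> (qRe x)\<close>.\<close>

lemma int_word_odd:
  "\<exists>a b c d :: int. int_word w = Quat (of_int (2 * a + 1)) (of_int (2 * b)) (of_int (2 * c)) (of_int (2 * d))"
proof (induction w)
  case Nil
  show ?case by (intro exI[of _ 0]) (simp add: quat_eq_iff)
next
  case (Cons l w)
  then obtain a b c d :: int
    where N: "int_word w = Quat (of_int (2 * a + 1)) (of_int (2 * b)) (of_int (2 * c)) (of_int (2 * d))" by blast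
  define s :: int where "s = (if snd l then 1 else - 1)"
  have s: "sgn2 (snd l) = 2 * s" by (simp add: sgn2_def s_def)
  show ?case
  proof (cases "fst l")
    case True
    then show ?thesis
      by (intro exI[of _ "a - 2 * s * b"] exI[of _ "b + s * (2 * a + 1)"]
          exI[of _ "c - 2 * s * d"] exI[of _ "d + 2 * s * c"])
        (simp add: N int_letter_def s quat_eq_iff algebra_simps)
  next
    case False
    then show ?thesis
      by (intro exI[of _ "a - 2 * s * c"] exI[of _ "b + 2 * s * d"]
          exI[of _ "c + s * (2 * a + 1)"] exI[of _ "d - 2 * s * b"])
        (simp add: N int_letter_def s quat_eq_iff algebra_simps)
  qed
qed

lemma qRe_unit_word: "qRe (unit_word w) \<noteq> 0"
proof
  assume "qRe (unit_word w) = 0"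
  then have "qRe (int_word w) = 0" by (simp add: unit_word_int_word)
  then obtain a :: int where "real_of_int (2 * a + 1) = real_of_int 0" using int_word_odd[of w] by force
  then show False by (simp only: of_int_eq_iff) presburger
qed

section \<open>Linear algebra over division rings\<close>

text \<open>Gaussian elimination with coefficients on the left and unknowns on the right, the order
  that right linear combinations produce.\<close>

lemma homogeneous_solution:
  fixes c :: "'b \<Rightarrow> 'c \<Rightarrow> 'a::division_ring"
  assumes "finite B" "finite A" "card B < card A"
  shows "\<exists>d. (\<exists>a\<in>A. d a \<noteq> 0) \<and> (\<forall>b\<in>B. (\<Sum>a\<in>A. c b a * d a) = 0)"
  using assms
proof (induction B arbitrary: A c)
  case empty
  then show ?case by (intro exI[of _ "\<lambda>_. 1"]) (auto simp: card_gt_0_iff)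
next
  case (insert b B)
  show ?case
  proof (cases "\<forall>a\<in>A. c b a = 0")
    case True
    moreover obtain d where "\<exists>a\<in>A. d a \<noteq> 0" "\<forall>b\<in>B. (\<Sum>a\<in>A. c b a * d a) = 0"
      using insert.IH[of A c] insert.prems insert.hyps by auto
    ultimately show ?thesis by (intro exI[of _ d]) auto
  next
    case False
    then obtain a0 where a0: "a0 \<in> A" "c b a0 \<noteq> 0" by blast
    \<comment> \<open>Equation \<open>b\<close> is solved for the unknown \<open>a0\<close> and
      substituted into the others; \<open>e\<close> below restores that unknown.\<close>
    define c' where "c' b' a = c b' a - c b' a0 * (inverse (c b a0) * c b a)" for b' a
    have "card B < card (A - {a0})" using insert.prems insert.hyps a0 by simp
    then obtain d where d: "\<exists>a\<in>A - {a0}. d a \<noteq> 0"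
        "\<forall>b\<in>B. (\<Sum>a\<in>A - {a0}. c' b a * d a) = 0"
      using insert.IH[of "A - {a0}" c'] insert.prems by auto
    define s where "s = (\<Sum>a\<in>A - {a0}. c b a * d a)"
    define e where "e = d(a0 := - (inverse (c b a0) * s))"
    have sum: "(\<Sum>a\<in>A. c b' a * e a) =
        (\<Sum>a\<in>A - {a0}. c b' a * d a) - c b' a0 * (inverse (c b a0) * s)" for b'
    proof -
      have "(\<Sum>a\<in>A - {a0}. c b' a * e a) = (\<Sum>a\<in>A - {a0}. c b' a * d a)"
        by (rule sum.cong) (auto simp: e_def)
      then show ?thesis
        using insert.prems a0 by (simp add: sum.remove[of A a0] e_def)
    qed
    have "(\<Sum>a\<in>A. c b a * e a) = 0"
      unfolding sum using a0 by (simp add: s_def flip: mult.assoc)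
    moreover have "(\<Sum>a\<in>A. c b' a * e a) = 0" if "b' \<in> B" for b'
    proof -
      have "(\<Sum>a\<in>A - {a0}. c' b' a * d a) =
          (\<Sum>a\<in>A - {a0}. c b' a * d a) - c b' a0 * (inverse (c b a0) * s)"
        by (simp add: c'_def s_def left_diff_distrib sum_subtractf sum_distrib_left mult.assoc)
      then show ?thesis unfolding sum using d(2) that by simp
    qed
    moreover have "\<exists>a\<in>A. e a \<noteq> 0" using d(1) by (auto simp: e_def)
    ultimately show ?thesis by (intro exI[of _ e]) auto
  qed
qed

section \<open>Subspaces and points of the Grassmannian\<close>

lemma rscale_nth [simp]: "rscale x c $ i = x $ i * c"
  by (simp add: rscale_def)

lemma rscale_cancel [simp]: "c \<noteq> 0 \<Longrightarrow> rscale (rscale (x :: 'a::division_ring ^ 'n) c) (inverse c) = x"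
  by (simp add: vec_eq_iff mult.assoc)

lemma right_subspace_add: "right_subspace V \<Longrightarrow> x \<in> V \<Longrightarrow> y \<in> V \<Longrightarrow> x + y \<in> V"
  by (simp add: right_subspace_def)

lemma right_subspace_rscale: "right_subspace V \<Longrightarrow> x \<in> V \<Longrightarrow> rscale x c \<in> V"
  by (simp add: right_subspace_def)

lemma right_subspace_diff:
  assumes "right_subspace V" "x \<in> V" "y \<in> V"
  shows "x - y \<in> V"
proof -
  have "x + rscale y (- 1) \<in> V" using assms by (intro right_subspace_add right_subspace_rscale)
  moreover have "x + rscale y (- 1) = x - y" by (simp add: vec_eq_iff)
  ultimately show ?thesis by simp
qed

lemma right_subspace_axis:
  fixes V :: "('a::division_ring ^ 'n) set"
  assumes "right_subspace V" "x \<in> V" "x = axis i c" "c \<noteq> 0"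
  shows "axis i 1 \<in> V"
proof -
  have "axis i 1 = rscale x (inverse c)" using assms by (auto simp: vec_eq_iff axis_def)
  then show ?thesis using assms by (simp add: right_subspace_rscale)
qed

lemma Gr_right_subspace: "V \<in> Gr k \<Longrightarrow> right_subspace V"
  by (simp add: Gr_def)

lemma Gr_nonzero:
  fixes V :: "('a::division_ring ^ 'n) set"
  assumes "V \<in> Gr k" "1 \<le> k"
  obtains z i where "z \<in> V" "z $ i \<noteq> 0"
proof -
  obtain B where B: "finite B" "card B = k" "right_independent B" "right_span B = V"
    using assms by (auto simp: Gr_def has_right_dim_def)
  then obtain v where v: "v \<in> B" using assms(2) by fastforce
  \<comment> \<open>This combination equals \<open>v\<close>; if \<open>v\<close> were 0 it would be
    a nontrivial relation in \<open>B\<close>.\<close>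
  define c where "c w = (if w = v then 1 else 0 :: 'a)" for w
  have sum: "(\<Sum>w\<in>B. rscale w (c w)) = v"
  proof -
    have "rscale w (c w) = (if w = v then v else 0)" for w by (simp add: c_def vec_eq_iff)
    then show ?thesis using B(1) v by simp
  qed
  then have "v \<in> V" using B(4) unfolding right_span_def by (metis rangeI)
  moreover have "v \<noteq> 0"
    using B(3) sum v unfolding right_independent_def by (auto simp: c_def dest!: spec[of _ c])
  then obtain i where "v $ i \<noteq> 0" by (auto simp: vec_eq_iff)
  ultimately show thesis by (rule that)
qed

text \<open>If all unit vectors were combinations of \<open>k\<close> generators,
  \<open>homogeneous_solution\<close> would give a nontrivial relation among the coefficient
  vectors, hence among the unit vectors.\<close>

lemma Gr_misses_axis:
  fixes V :: "('a::division_ring ^ 'n::finite) set"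
  assumes "V \<in> Gr k" "k < CARD('n)"
  obtains i where "axis i 1 \<notin> V"
proof (rule ccontr)
  assume "\<not> thesis"
  then have ax: "axis i 1 \<in> V" for i using that by blast
  obtain B where B: "finite B" "card B = k" "right_span B = V"
    using assms by (auto simp: Gr_def has_right_dim_def)
  have "\<exists>c. axis i 1 = (\<Sum>v\<in>B. rscale v (c v))" for i
    using ax[of i] unfolding B(3)[symmetric] right_span_def by auto
  then obtain c where c: "\<And>i. axis i 1 = (\<Sum>v\<in>B. rscale v (c i v))" by metis
  obtain d where d: "\<exists>i. d i \<noteq> 0" "\<forall>v\<in>B. (\<Sum>i\<in>UNIV. c i v * d i) = 0"
    using homogeneous_solution[of B "UNIV :: 'n set" "\<lambda>v i. c i v"] B assms(2) by auto
  have "d j = 0" for j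
  proof -
    have ax': "(if j = i then 1 else 0) = (\<Sum>v\<in>B. v $ j * c i v)" for i
      using arg_cong[OF c[of i], of "\<lambda>x. x $ j"] by (simp add: axis_def eq_commute)
    have "d j = (\<Sum>i\<in>UNIV. (if j = i then 1 else 0) * d i)"
      by (simp add: if_distrib[of "\<lambda>x. x * _"] cong: if_cong)
    also have "\<dots> = (\<Sum>i\<in>UNIV. \<Sum>v\<in>B. v $ j * (c i v * d i))"
      unfolding ax' by (simp add: sum_distrib_right mult.assoc)
    also have "\<dots> = (\<Sum>v\<in>B. v $ j * (\<Sum>i\<in>UNIV. c i v * d i))"
      by (subst sum.swap) (simp add: sum_distrib_left)
    also have "\<dots> = 0" using d(2) by simp
    finally show ?thesis .
  qed
  then show False using d(1) by blast
qed

text \<open>The witness is spanned by \<open>k\<close> of the unit vectors.\<close>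

lemma Gr_nonempty:
  assumes "k \<le> CARD('n::finite)"
  shows "(Gr k :: ('a::division_ring ^ 'n) set set) \<noteq> {}"
proof -
  obtain I :: "'n set" where I: "card I = k" using obtain_subset_with_card_n[OF assms] by auto
  define B where "B = (\<lambda>i. axis i (1 :: 'a)) ` I"
  have inj: "inj_on (\<lambda>i. axis i (1 :: 'a)) I" by (rule inj_onI) (simp add: axis_eq_axis)
  have "right_subspace (right_span B)"
    unfolding right_subspace_def
  proof (intro conjI ballI allI)
    show "0 \<in> right_span B"
      unfolding right_span_def by (rule range_eqI[of _ _ "\<lambda>_. 0"]) (simp add: vec_eq_iff)
  next
    fix x y assume "x \<in> right_span B" "y \<in> right_span B"
    then obtain c d where "x = (\<Sum>v\<in>B. rscale v (c v))" "y = (\<Sum>v\<in>B. rscale v (d v))"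
      unfolding right_span_def by blast
    then show "x + y \<in> right_span B"
      unfolding right_span_def
      by (intro range_eqI[of _ _ "\<lambda>v. c v + d v"]) (simp add: vec_eq_iff distrib_left sum.distrib)
  next
    fix x a assume "x \<in> right_span B"
    then obtain c where "x = (\<Sum>v\<in>B. rscale v (c v))"
      unfolding right_span_def by blast
    then show "rscale x a \<in> right_span B"
      unfolding right_span_def
      by (intro range_eqI[of _ _ "\<lambda>v. c v * a"]) (simp add: vec_eq_iff sum_distrib_right mult.assoc)
  qed
  moreover have "right_independent B"
    unfolding right_independent_def B_def
  proof (intro allI impI ballI)
    fix c v assume 0: "(\<Sum>v\<in>(\<lambda>i. axis i (1 :: 'a)) ` I. rscale v (c v)) = 0"
      and "v \<in> (\<lambda>i. axis i (1 :: 'a)) ` I"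
    then obtain j where j: "j \<in> I" "v = axis j 1" by blast
    have "0 = (\<Sum>i\<in>I. axis i 1 $ j * c (axis i 1))"
      using arg_cong[OF 0, of "\<lambda>x. x $ j"] by (simp add: sum.reindex[OF inj])
    also have "\<dots> = (\<Sum>i\<in>I. if i = j then c v else 0)"
      by (rule sum.cong) (auto simp: axis_def j)
    finally show "c v = 0" using j by (simp add: sum.delta)
  qed
  moreover have "finite B" "card B = k" using I by (simp_all add: B_def card_image[OF inj])
  ultimately show ?thesis unfolding Gr_def has_right_dim_def by blast
qed

text \<open>A nonzero coordinate \<open>i\<close> yields every other unit vector; the
  \<open>i\<close>-th one itself is reached by a detour through some \<open>j \<noteq> i\<close>.
  Then \<open>V\<close> would contain all unit vectors.\<close>

lemma Gr_not_spread:
  fixes V :: "('a::division_ring ^ 'n::finite) set"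
  assumes V: "V \<in> Gr k" and k: "1 \<le> k" "k < CARD('n)"
    and spread: "\<And>z i j. z \<in> V \<Longrightarrow> z $ i \<noteq> 0 \<Longrightarrow> i \<noteq> j \<Longrightarrow> axis j 1 \<in> V"
  shows False
proof -
  obtain z i where z: "z \<in> V" "z $ i \<noteq> 0" using Gr_nonzero[OF V k(1)] by blast
  obtain m where m: "axis m 1 \<notin> V" using Gr_misses_axis[OF V k(2)] by blast
  have "UNIV \<noteq> {i}" using k by (metis One_nat_def card.empty card.insert empty_iff finite.emptyI not_less)
  then obtain j where "j \<noteq> i" by blast
  then have "axis j 1 \<in> V" using spread[OF z, of j] by blast
  then have "axis i 1 \<in> V" using spread[of "axis j 1" j i] \<open>j \<noteq> i\<close> by simp
  then show False using spread[OF z, of m] m by blast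
qed

section \<open>Isometric actions of the unit quaternions\<close>

text \<open>The group acts on arbitrary sets of vectors; the Grassmannian and its parts enter as the
  sets \<open>E\<close>.\<close>

interpretation isometry: total_action isometry_group "\<lambda>g V. g ` (V :: ('a::conj_div_algebra ^ 'n) set)"
  unfolding total_action_def total_action_axioms_def
  by (intro conjI group_isometry_group) (auto simp: isometry_group_def image_comp)

text \<open>For each generator, staying put on \<open>X (k, False)\<close> and applying
  \<open>g k\<close> elsewhere embeds \<open>E\<close> into the two pieces of that generator. The
  pieces of the two generators are disjoint.\<close>

lemma (in total_action) doubling_if_four_pieces:
  assumes g: "\<And>k. g k \<in> carrier G"
    and X: "\<And>l :: letter. X l \<subseteq> E" "\<And>l l'. l \<noteq> l' \<Longrightarrow> X l \<inter> X l' = {}"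
    and img: "\<And>k. \<phi> (g k) ` (E - X (k, False)) = X (k, True)"
  shows "doubling E"
proof -
  define f where "f k x = (if x \<in> X (k, False) then x else \<phi> (g k) x)" for k x
  have pw: "piecewise E (f k)" for k
    unfolding f_def by (intro piecewise_if piecewise_id piecewise_act g)
  have moved: "f k x \<in> X (k, True)" if "x \<in> E" "x \<notin> X (k, False)" for k x
    using img[of k] that by (auto simp: f_def)
  have mem: "f k x \<in> X (k, True) \<union> X (k, False)" if "x \<in> E" for k x
    using moved[OF that] by (auto simp: f_def)
  have inj: "inj_on (f k) E" for k
  proof (rule inj_onI)
    fix x y assume xy: "x \<in> E" "y \<in> E" "f k x = f k y"
    have "X (k, True) \<inter> X (k, False) = {}" by (rule X) simp
    moreover have "x \<in> X (k, False) \<Longrightarrow> f k x = x" "y \<in> X (k, False) \<Longrightarrow> f k y = y"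
      by (simp_all add: f_def)
    ultimately have "x \<in> X (k, False) \<longleftrightarrow> y \<in> X (k, False)"
      using moved[OF xy(1), of k] moved[OF xy(2), of k] xy(3) by (metis disjoint_iff)
    then show "x = y" using xy(3) injD[OF act_inj[OF g]] by (auto simp: f_def split: if_splits)
  qed
  have "(X (True, True) \<union> X (True, False)) \<inter> (X (False, True) \<union> X (False, False)) = {}"
    using X(2)[of "(True, True)" "(False, True)"] X(2)[of "(True, True)" "(False, False)"]
      X(2)[of "(True, False)" "(False, True)"] X(2)[of "(True, False)" "(False, False)"] by auto
  moreover have "f k ` E \<subseteq> X (k, True) \<union> X (k, False)" for k using mem by blast
  ultimately have "f True ` E \<inter> f False ` E = {}" by blast
  moreover have "f k ` E \<subseteq> E" for k using mem X(1) by blast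
  ultimately show ?thesis unfolding doubling_def using pw inj by blast
qed

text \<open>\<open>D\<close> is, up to the real factor \<open>\<kappa>\<close>, the derived representation of the Lie algebra of imaginary
  quaternions, extended by \<open>0\<close> to the real ones.\<close>

locale quaternion_rep =
  fixes \<rho> :: "quat \<Rightarrow> 'a::conj_div_algebra ^ 'n \<Rightarrow> 'a ^ 'n"
    and D :: "quat \<Rightarrow> 'a ^ 'n \<Rightarrow> 'a ^ 'n"
    and \<kappa> :: "real \<Rightarrow> real"
  assumes rho_one: "\<rho> 1 z = z"
    and rho_mult: "\<rho> (x * y) z = \<rho> x (\<rho> y z)"
    and rho_linear: "right_linear (\<rho> x)"
    and rho_norm: "qnorm2 x = 1 \<Longrightarrow> innerK (\<rho> x z) (\<rho> x z) = innerK z z"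
    and rho_conjK: "\<rho> x z - \<rho> (conjK x) z = rscale (D x z) (of_real (\<kappa> (qRe x)))"
    and kappa_nonzero: "r \<noteq> 0 \<Longrightarrow> \<kappa> r \<noteq> 0"
    and D_add: "D (x + y) z = D x z + D y z"
    and D_scaleR: "D (r *\<^sub>R x) z = rscale (D x z) (of_real r)"
    and D_one: "D 1 z = 0"
    and D_commutator: "D (x * y - y * x) z = D x (D y z) - D y (D x z)"
begin

lemma rho_add: "\<rho> x (y + z) = \<rho> x y + \<rho> x z"
  using rho_linear by (simp add: right_linear_def)

lemma rho_rscale: "\<rho> x (rscale z c) = rscale (\<rho> x z) c"
  using rho_linear by (simp add: right_linear_def)

lemma rho_diff: "\<rho> x (y - z) = \<rho> x y - \<rho> x z"
  using rho_add[of x "y - z" z] by simp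

lemma rho_cancel:
  assumes "qnorm2 x = 1"
  shows "\<rho> (conjK x) (\<rho> x z) = z" "\<rho> x (\<rho> (conjK x) z) = z"
  using assms by (simp_all add: conjK_mult_self rho_one flip: rho_mult)

lemma rho_isometry:
  assumes "qnorm2 x = 1"
  shows "\<rho> x \<in> carrier isometry_group"
proof -
  have "bij (\<rho> x)" by (rule o_bij[of "\<rho> (conjK x)"]) (simp_all add: fun_eq_iff rho_cancel assms)
  then show ?thesis
    using assms by (simp add: isometry_group_def rho_linear distK_def rho_norm flip: rho_diff)
qed

text \<open>The stabilizer of \<open>V\<close> in the Lie algebra, enlarged by the real quaternions,
  on which \<open>D\<close> vanishes.\<close>

definition lie :: "('a ^ 'n) set \<Rightarrow> quat set" where
  "lie V = {x. \<forall>z\<in>V. D x z \<in> V}"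

lemma lie_closed:
  assumes "right_subspace V"
  shows "1 \<in> lie V"
    "x \<in> lie V \<Longrightarrow> y \<in> lie V \<Longrightarrow> x + y \<in> lie V"
    "x \<in> lie V \<Longrightarrow> r *\<^sub>R x \<in> lie V"
    "x \<in> lie V \<Longrightarrow> y \<in> lie V \<Longrightarrow> x * y - y * x \<in> lie V"
  using assms
  by (simp_all add: lie_def D_one D_add D_scaleR D_commutator right_subspace_add
      right_subspace_rscale right_subspace_diff) (simp add: right_subspace_def)

text \<open>The inverse \<open>conjK x\<close> stabilizes \<open>V\<close> too, and the difference
  of the two actions is a nonzero real multiple of \<open>D x\<close>.\<close>

lemma lie_if_stabilizer:
  assumes V: "right_subspace V" and x: "qnorm2 x = 1" "qRe x \<noteq> 0" and stab: "\<rho> x ` V = V"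
  shows "x \<in> lie V"
  unfolding lie_def
proof (intro CollectI ballI)
  fix z assume z: "z \<in> V"
  then have "\<rho> x z \<in> V" using stab by blast
  moreover have "\<rho> (conjK x) z \<in> V" using z stab rho_cancel(1)[OF x(1)] by (metis imageE)
  ultimately have "rscale (D x z) (of_real (\<kappa> (qRe x))) \<in> V"
    using V by (simp add: right_subspace_diff flip: rho_conjK)
  then have "rscale (rscale (D x z) (of_real (\<kappa> (qRe x)))) (inverse (of_real (\<kappa> (qRe x)))) \<in> V"
    using V by (simp add: right_subspace_rscale)
  then show "D x z \<in> V" using kappa_nonzero[OF x(2)] by simp
qed

lemma lie_eq_UNIV_if_noncommuting:
  assumes V: "right_subspace V" and xy: "x \<in> lie V" "y \<in> lie V" "x * y \<noteq> y * x"
  shows "lie V = UNIV"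
proof -
  define n where "n = x * y - y * x"
  \<comment> \<open>The commutator is twice the cross product of the imaginary parts, hence
    perpendicular to both.\<close>
  have n: "qI n = 2 * (qJ x * qK y - qK x * qJ y)" "qJ n = 2 * (qK x * qI y - qI x * qK y)"
    "qK n = 2 * (qI x * qJ y - qJ x * qI y)" "qRe n = 0"
    by (simp_all add: n_def algebra_simps)
  have "n \<noteq> 0" using xy(3) by (simp add: n_def)
  then have n0: "qnorm2 n \<noteq> 0" using quat_norm_sq_pos[of n] by (simp add: qnorm2_def power2_eq_square)
  have "u \<in> lie V" for u
  proof -
    \<comment> \<open>Cramer's rule for the basis \<open>1, x, y, n\<close>, with determinants written as triple products with \<open>n\<close>\<close>
    define \<alpha> where "\<alpha> = 2 * ((qJ u * qK y - qK u * qJ y) * qI n + (qK u * qI y - qI u * qK y) * qJ n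
      + (qI u * qJ y - qJ u * qI y) * qK n)"
    define \<beta> where "\<beta> = 2 * ((qJ x * qK u - qK x * qJ u) * qI n + (qK x * qI u - qI x * qK u) * qJ n
      + (qI x * qJ u - qJ x * qI u) * qK n)"
    define \<gamma> where "\<gamma> = qI u * qI n + qJ u * qJ n + qK u * qK n"
    define \<delta> where "\<delta> = qnorm2 n * qRe u - \<alpha> * qRe x - \<beta> * qRe y"
    have eq: "qnorm2 n *\<^sub>R u = \<delta> *\<^sub>R 1 + \<alpha> *\<^sub>R x + \<beta> *\<^sub>R y + \<gamma> *\<^sub>R n"
      unfolding quat_eq_iff quat_sel \<delta>_def unfolding \<alpha>_def \<beta>_def \<gamma>_def qnorm2_def n
      by (simp add: algebra_simps)
    have "\<delta> *\<^sub>R 1 + \<alpha> *\<^sub>R x + \<beta> *\<^sub>R y + \<gamma> *\<^sub>R n \<in> lie V"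
      unfolding n_def by (intro lie_closed V xy)
    then have "(1 / qnorm2 n) *\<^sub>R (qnorm2 n *\<^sub>R u) \<in> lie V"
      unfolding eq by (rule lie_closed(3)[OF V])
    then show ?thesis using n0 by simp
  qed
  then show ?thesis by blast
qed

text \<open>Conjugation by \<open>x\<close> preserves the real part and commutes with
  \<open>conjK\<close>, so \<open>rho_conjK\<close> turns equivariance of \<open>\<rho>\<close> into
  equivariance of \<open>D\<close> after division by \<kappa>.\<close>

lemma D_equivariant:
  assumes x: "qnorm2 x = 1" and y: "qRe y \<noteq> 0"
  shows "D (x * y * conjK x) (\<rho> x z) = \<rho> x (D y z)"
proof -
  have conj: "conjK (x * y * conjK x) = x * conjK y * conjK x"
    by (simp add: conjK_mult conjK_conjK mult.assoc)
  have re: "qRe (x * y * conjK x) = qRe y"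
  proof -
    have "qRe (x * y * conjK x) = qnorm2 x * qRe y" by (simp add: qnorm2_def algebra_simps)
    then show ?thesis by (simp add: x)
  qed
  let ?k = "of_real (\<kappa> (qRe y)) :: 'a"
  have "rscale (D (x * y * conjK x) (\<rho> x z)) ?k =
      \<rho> (x * y * conjK x) (\<rho> x z) - \<rho> (x * conjK y * conjK x) (\<rho> x z)"
    using rho_conjK[of "x * y * conjK x" "\<rho> x z"] by (simp only: conj re)
  also have "\<dots> = \<rho> x (\<rho> y z - \<rho> (conjK y) z)"
    by (simp add: rho_mult rho_cancel x rho_diff)
  also have "\<dots> = rscale (\<rho> x (D y z)) ?k"
    by (simp add: rho_conjK rho_rscale)
  finally have "rscale (rscale (D (x * y * conjK x) (\<rho> x z)) ?k) (inverse ?k)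
      = rscale (rscale (\<rho> x (D y z)) ?k) (inverse ?k)" by simp
  then show ?thesis
    using kappa_nonzero[OF y] by simp
qed

text \<open>Read contrapositively, this makes the set \<open>moved k\<close> below invariant under
  the words.\<close>

lemma lie_image:
  assumes V: "right_subspace V" and x: "qnorm2 x = 1" and UNIV: "lie (\<rho> x ` V) = UNIV"
  shows "lie V = UNIV"
proof -
  have nz: "y \<in> lie V" if y: "qRe y \<noteq> 0" for y
    unfolding lie_def
  proof (intro CollectI ballI)
    fix z assume "z \<in> V"
    then have "D (x * y * conjK x) (\<rho> x z) \<in> \<rho> x ` V" using UNIV unfolding lie_def by blast
    then have "\<rho> x (D y z) \<in> \<rho> x ` V" by (simp add: D_equivariant x y)
    then show "D y z \<in> V" using rho_cancel(1)[OF x] by (metis imageE)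
  qed
  have "y \<in> lie V" for y
  proof -
    \<comment> \<open>Shifting the real part to 1 reaches the case already treated; real multiples
      of 1 always lie in \<open>lie V\<close>.\<close>
    have "y + (1 - qRe y) *\<^sub>R 1 \<in> lie V" by (rule nz) simp
    then have "(y + (1 - qRe y) *\<^sub>R 1) + (qRe y - 1) *\<^sub>R 1 \<in> lie V"
      by (rule lie_closed(2)[OF V]) (intro lie_closed V)
    then show ?thesis by (simp add: algebra_simps)
  qed
  then show ?thesis by blast
qed

definition moved :: "nat \<Rightarrow> ('a ^ 'n) set set" where
  "moved k = {V \<in> Gr k. lie V \<noteq> UNIV}"

lemma moved_subset: "moved k \<subseteq> Gr k"
  by (auto simp: moved_def)

text \<open>Words fixing a moved \<open>V\<close> lie in the proper subset \<open>lie V\<close>, so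
  they commute as quaternions and therefore as Sanov matrices.\<close>

lemma doubling_moved: "isometry.doubling (moved k)"
proof -
  define act where "act w V = \<rho> (unit_word w) ` V" for w V
  interpret word_action act "moved k"
  proof
    fix V v w l
    show "act [] V = V" by (simp add: act_def rho_one)
    show "act (v @ w) V = act v (act w V)" by (simp add: act_def unit_word_append rho_mult image_image)
    show "act [linv l, l] V = V" unfolding act_def unit_word_cancel by (simp add: rho_one)
    assume V: "V \<in> moved k"
    then have sub: "right_subspace V" and lie: "lie V \<noteq> UNIV"
      by (auto simp: moved_def Gr_right_subspace)
    show "act w V \<in> moved k"
      using V image_mem_Gr[OF rho_isometry[OF qnorm2_unit_word]] lie_image[OF sub qnorm2_unit_word] lie
      unfolding moved_def act_def by blast
    assume "act v V = V" "act w V = V"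
    then have "unit_word v \<in> lie V" "unit_word w \<in> lie V"
      unfolding act_def by (auto intro: lie_if_stabilizer[OF sub] simp: qRe_unit_word)
    then have "unit_word v * unit_word w = unit_word w * unit_word v" using lie_eq_UNIV_if_noncommuting[OF sub] lie by blast
    then show "sanov v \<circ> sanov w = sanov w \<circ> sanov v" by (rule sanov_commute_if_unit_word_commute)
  qed
  obtain X where X: "\<And>l. X l \<subseteq> moved k" "\<And>l l'. l \<noteq> l' \<Longrightarrow> X l \<inter> X l' = {}"
    "\<And>k'. act [(k', True)] ` (moved k - X (k', False)) = X (k', True)"
    by (rule four_pieces) (rule that)
  show ?thesis
  proof (rule isometry.doubling_if_four_pieces[OF _ X(1,2)])
    show "\<rho> (unit_word [(b, True)]) \<in> carrier isometry_group" for b by (rule rho_isometry) (rule qnorm2_unit_word)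
    show "(`) (\<rho> (unit_word [(b, True)])) ` (moved k - X (b, False)) = X (b, True)" for b
      using X(3)[of b] unfolding act_def .
  qed
qed

lemma D_mem_if_not_moved: "V \<in> Gr k \<Longrightarrow> V \<notin> moved k \<Longrightarrow> z \<in> V \<Longrightarrow> D x z \<in> V"
  by (auto simp: moved_def lie_def)

end

section \<open>Three families of actions\<close>

lemma conjK_zero [simp]: "conjK (0 :: 'a::conj_div_algebra) = 0"
  using conjK_add[of "0 :: 'a" 0] by simp

lemma conjK_minus: "conjK (- x :: 'a::conj_div_algebra) = - conjK x"
  using conjK_add[of x "- x"] by (simp add: eq_neg_iff_add_eq_0 add.commute)

lemma rscale_2: "rscale (z :: 'a::real_div_algebra ^ 'n) (of_real 2) = z + z"
  by (simp add: vec_eq_iff mult_2_right)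

lemma sum_UNIV_remove2:
  fixes f :: "'n::finite \<Rightarrow> 'a::ab_group_add"
  assumes "i \<noteq> j"
  shows "sum f UNIV = f i + f j + sum f (UNIV - {i, j})"
proof -
  have "sum f UNIV = f i + sum f (UNIV - {i})" by (simp add: sum.remove)
  also have "sum f (UNIV - {i}) = f j + sum f (UNIV - {i} - {j})"
    using assms by (intro sum.remove) auto
  also have "UNIV - {i} - {j} = UNIV - {i, j}" by auto
  finally show ?thesis by (simp add: add.assoc)
qed

text \<open>The action of \<open>Sp(1)\<close> on one coordinate; left multiplication commutes with
  the right scalars.\<close>

definition lmul :: "'n \<Rightarrow> quat \<Rightarrow> quat ^ 'n \<Rightarrow> quat ^ 'n" where
  "lmul i x z = (\<chi> l. if l = i then x * z $ l else z $ l)"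

definition dlmul :: "'n \<Rightarrow> quat \<Rightarrow> quat ^ 'n \<Rightarrow> quat ^ 'n" where
  "dlmul i x z = axis i ((x - qRe x *\<^sub>R 1) * z $ i)"

lemma quaternion_rep_lmul: "quaternion_rep (lmul i) (dlmul i) (\<lambda>_. 2)"
proof
  fix x y :: quat and z :: "quat ^ 'a" and r :: real
  show "lmul i 1 z = z" by (simp add: lmul_def vec_eq_iff)
  show "lmul i (x * y) z = lmul i x (lmul i y z)" by (simp add: lmul_def vec_eq_iff mult.assoc)
  show "right_linear (lmul i x)"
    by (simp add: right_linear_def lmul_def vec_eq_iff distrib_left mult.assoc)
  show "innerK (lmul i x z) (lmul i x z) = innerK z z" if x: "qnorm2 x = 1"
  proof -
    have "conjK (x * w) * (x * w) = conjK w * w" for w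
    proof -
      have "conjK (x * w) * (x * w) = conjK w * (conjK x * x) * w"
        by (simp only: conjK_mult mult.assoc)
      then show ?thesis by (simp add: conjK_mult_self x)
    qed
    then show ?thesis unfolding innerK_def by (intro sum.cong) (simp_all add: lmul_def)
  qed
  show "lmul i x z - lmul i (conjK x) z = rscale (dlmul i x z) (of_real 2)"
    by (auto simp: lmul_def dlmul_def vec_eq_iff axis_def quat_eq_iff of_real_def algebra_simps)
  show "dlmul i (x + y) z = dlmul i x z + dlmul i y z"
    by (simp add: dlmul_def vec_eq_iff axis_def algebra_simps)
  show "dlmul i (r *\<^sub>R x) z = rscale (dlmul i x z) (of_real r)"
    by (auto simp: dlmul_def vec_eq_iff axis_def quat_eq_iff of_real_def algebra_simps)
  show "dlmul i 1 z = 0" by (simp add: dlmul_def)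
  show "dlmul i (x * y - y * x) z = dlmul i x (dlmul i y z) - dlmul i y (dlmul i x z)"
    by (auto simp: dlmul_def vec_eq_iff axis_def algebra_simps)
qed simp

text \<open>Serves the complex numbers and the quaternions alike. Matrices with entries in the real
  span of 1 and \<open>I\<close> act from the left, so the maps are right linear even where
  \<open>I\<close> is not central.\<close>

locale complex_structure =
  fixes I :: "'a::conj_div_algebra"
  assumes conjK_scaleR: "conjK (r *\<^sub>R x) = r *\<^sub>R conjK (x :: 'a)"
    and I_I: "I * I = - 1"
    and conjK_I: "conjK I = - I"
begin

lemma I_I_left: "I * (I * x) = - x"
  by (simp add: I_I flip: mult.assoc)

text \<open>The unit quaternion \<open>(a + b i) + (c + d i) j\<close> acts on the coordinates \<open>i, j\<close> by the matrix with rows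
  \<open>a + b i, c + d i\<close> and \<open>- c + d i, a - b i\<close> of \<open>SU(2)\<close>.\<close>

definition su2 :: "'n \<Rightarrow> 'n \<Rightarrow> quat \<Rightarrow> 'a ^ 'n \<Rightarrow> 'a ^ 'n" where
  "su2 i j x z = (\<chi> l.
     if l = i then qRe x *\<^sub>R z $ i + qI x *\<^sub>R (I * z $ i) + qJ x *\<^sub>R z $ j + qK x *\<^sub>R (I * z $ j)
     else if l = j then qRe x *\<^sub>R z $ j - qI x *\<^sub>R (I * z $ j) - qJ x *\<^sub>R z $ i + qK x *\<^sub>R (I * z $ i)
     else z $ l)"

definition dsu2 :: "'n \<Rightarrow> 'n \<Rightarrow> quat \<Rightarrow> 'a ^ 'n \<Rightarrow> 'a ^ 'n" where
  "dsu2 i j x z = (\<chi> l.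
     if l = i then qI x *\<^sub>R (I * z $ i) + qJ x *\<^sub>R z $ j + qK x *\<^sub>R (I * z $ j)
     else if l = j then - qI x *\<^sub>R (I * z $ j) - qJ x *\<^sub>R z $ i + qK x *\<^sub>R (I * z $ i)
     else 0)"

lemma su2_norm:
  assumes "a * a + b * b + c * c + d * d = 1"
    and "u = a *\<^sub>R p + b *\<^sub>R (I * p) + c *\<^sub>R q + d *\<^sub>R (I * q)"
    and "v = a *\<^sub>R q - b *\<^sub>R (I * q) - c *\<^sub>R p + d *\<^sub>R (I * p)"
  shows "conjK u * u + conjK v * v = conjK p * p + conjK q * q"
proof -
  have conj: "conjK u = a *\<^sub>R conjK p - b *\<^sub>R (conjK p * I) + c *\<^sub>R conjK q - d *\<^sub>R (conjK q * I)"
    "conjK v = a *\<^sub>R conjK q + b *\<^sub>R (conjK q * I) - c *\<^sub>R conjK p - d *\<^sub>R (conjK p * I)"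
    by (simp_all add: assms(2,3) conjK_add conjK_scaleR conjK_mult conjK_I conjK_minus
        diff_conv_add_uminus del: add_uminus_conv_diff)
  have "conjK u * u + conjK v * v =
      (a * a + b * b + c * c + d * d) *\<^sub>R (conjK p * p + conjK q * q)"
    unfolding conj unfolding assms(2,3) by (simp add: algebra_simps I_I_left)
  then show ?thesis by (simp add: assms(1))
qed

lemma quaternion_rep_su2:
  fixes i j :: "'n::finite"
  assumes ij: "i \<noteq> j"
  shows "quaternion_rep (su2 i j) (dsu2 i j) (\<lambda>_. 2)"
proof
  fix x y :: quat and z :: "'a ^ 'n" and r :: real
  show "su2 i j 1 z = z" using ij by (simp add: su2_def vec_eq_iff)
  show "su2 i j (x * y) z = su2 i j x (su2 i j y z)"
    using ij by (auto simp: su2_def vec_eq_iff algebra_simps I_I_left)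
  show "right_linear (su2 i j x)"
    by (auto simp: right_linear_def su2_def vec_eq_iff algebra_simps)
  show "innerK (su2 i j x z) (su2 i j x z) = innerK z z" if x: "qnorm2 x = 1"
  proof -
    define w where "w = su2 i j x z"
    have "conjK (w $ i) * w $ i + conjK (w $ j) * w $ j = conjK (z $ i) * z $ i + conjK (z $ j) * z $ j"
      by (rule su2_norm) (use x ij in \<open>simp_all add: qnorm2_def w_def su2_def\<close>)
    moreover have "(\<Sum>l\<in>UNIV - {i, j}. conjK (w $ l) * w $ l) = (\<Sum>l\<in>UNIV - {i, j}. conjK (z $ l) * z $ l)"
      by (rule sum.cong) (auto simp: w_def su2_def)
    ultimately show ?thesis
      unfolding w_def[symmetric] innerK_def sum_UNIV_remove2[OF ij] by simp
  qed
  show "su2 i j x z - su2 i j (conjK x) z = rscale (dsu2 i j x z) (of_real 2)"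
    unfolding rscale_2 by (auto simp: su2_def dsu2_def vec_eq_iff algebra_simps)
  show "dsu2 i j (x + y) z = dsu2 i j x z + dsu2 i j y z"
    by (auto simp: dsu2_def vec_eq_iff algebra_simps)
  show "dsu2 i j (r *\<^sub>R x) z = rscale (dsu2 i j x z) (of_real r)"
    by (auto simp: dsu2_def vec_eq_iff of_real_def algebra_simps)
  show "dsu2 i j 1 z = 0" by (simp add: dsu2_def vec_eq_iff)
  show "dsu2 i j (x * y - y * x) z = dsu2 i j x (dsu2 i j y z) - dsu2 i j y (dsu2 i j x z)"
  proof -
    \<comment> \<open>Quaternion commutators produce coefficients with a factor 2; splitting them
      into sums lets the terms cancel.\<close>
    have "(a * 2) *\<^sub>R v = a *\<^sub>R v + a *\<^sub>R v" "(a * (b * 2)) *\<^sub>R v = (a * b) *\<^sub>R v + (a * b) *\<^sub>R v"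
      for a b :: real and v :: 'a by (simp_all flip: scaleR_left_distrib)
    then show ?thesis
      using ij by (auto simp: dsu2_def vec_eq_iff algebra_simps I_I_left)
  qed
qed simp

end

interpretation cpx: complex_structure \<i>
  by standard (simp_all add: conjK_complex_def)

interpretation qt: complex_structure "Quat 0 1 0 0"
  by standard (simp_all add: quat_eq_iff)

section \<open>Rotations of three real coordinates\<close>

definition so3_vec :: "'n \<Rightarrow> 'n \<Rightarrow> 'n \<Rightarrow> real ^ 'n \<Rightarrow> quat" where
  "so3_vec i j k z = Quat 0 (z $ i) (z $ j) (z $ k)"

text \<open>The double cover of \<open>SO(3)\<close>: unit quaternions conjugate the imaginary
  quaternions. Its derivative \<open>dso3\<close> is the commutator.\<close>

definition so3 :: "'n \<Rightarrow> 'n \<Rightarrow> 'n \<Rightarrow> quat \<Rightarrow> real ^ 'n \<Rightarrow> real ^ 'n" where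
  "so3 i j k x z = (\<chi> l. let y = x * so3_vec i j k z * conjK x in
     if l = i then qI y else if l = j then qJ y else if l = k then qK y else z $ l)"

definition dso3 :: "'n \<Rightarrow> 'n \<Rightarrow> 'n \<Rightarrow> quat \<Rightarrow> real ^ 'n \<Rightarrow> real ^ 'n" where
  "dso3 i j k x z = (\<chi> l. let y = x * so3_vec i j k z - so3_vec i j k z * x in
     if l = i then qI y else if l = j then qJ y else if l = k then qK y else 0)"

lemma quaternion_rep_so3:
  fixes i j k :: "'n::finite"
  assumes ijk: "i \<noteq> j" "i \<noteq> k" "j \<noteq> k"
  shows "quaternion_rep (so3 i j k) (dso3 i j k) (\<lambda>r. 2 * r)"
proof
  fix x y :: quat and z z' :: "real ^ 'n" and r :: real
  let ?v = "so3_vec i j k"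
  have v_so3: "?v (so3 i j k x z) = x * ?v z * conjK x" for x z
    using ijk by (simp add: so3_def so3_vec_def quat_eq_iff Let_def algebra_simps)
  have v_dso3: "?v (dso3 i j k x z) = x * ?v z - ?v z * x" for x z
    using ijk by (simp add: dso3_def so3_vec_def quat_eq_iff Let_def algebra_simps)
  \<comment> \<open>Comparing the imaginary quaternion and the untouched coordinates reduces each
    law to a quaternion identity.\<close>
  have eqI: "w = w'" if "?v w = ?v w'" "\<And>l. l \<noteq> i \<Longrightarrow> l \<noteq> j \<Longrightarrow> l \<noteq> k \<Longrightarrow> w $ l = w' $ l" for w w'
    using that unfolding vec_eq_iff so3_vec_def by (metis quat.inject)
  have v_lin: "?v (w + w') = ?v w + ?v w'" "?v (w - w') = ?v w - ?v w'"
    "?v (rscale w c) = c *\<^sub>R ?v w" "?v 0 = 0" for w w' c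
    by (simp_all add: so3_vec_def quat_eq_iff)
  have rest: "l \<noteq> i \<Longrightarrow> l \<noteq> j \<Longrightarrow> l \<noteq> k \<Longrightarrow> so3 i j k x z $ l = z $ l"
    "l \<noteq> i \<Longrightarrow> l \<noteq> j \<Longrightarrow> l \<noteq> k \<Longrightarrow> dso3 i j k x z $ l = 0" for l x z
    by (simp_all add: so3_def dso3_def)
  have conj_1: "conjK 1 = (1 :: quat)" by (simp add: quat_eq_iff)
  show "so3 i j k 1 z = z" by (rule eqI) (simp_all add: v_so3 rest conj_1)
  show "so3 i j k (x * y) z = so3 i j k x (so3 i j k y z)"
    by (rule eqI) (simp_all add: v_so3 rest conjK_mult mult.assoc)
  have "so3 i j k x (w + w') = so3 i j k x w + so3 i j k x w'" for w w'
    by (rule eqI) (simp_all add: v_so3 rest v_lin algebra_simps)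
  moreover have "so3 i j k x (rscale w c) = rscale (so3 i j k x w) c" for w c
    by (rule eqI) (simp_all add: v_so3 rest v_lin)
  ultimately show "right_linear (so3 i j k x)" by (simp add: right_linear_def)
  show "innerK (so3 i j k x z) (so3 i j k x z) = innerK z z" if x: "qnorm2 x = 1"
  proof -
    have inner: "innerK w w = qnorm2 (?v w) + (\<Sum>l\<in>UNIV - {i, j} - {k}. w $ l * w $ l)" for w
    proof -
      have "sum f (UNIV - {i, j}) = f k + sum f (UNIV - {i, j} - {k})" for f :: "'n \<Rightarrow> real"
        using ijk by (intro sum.remove) auto
      then show ?thesis
        unfolding innerK_def sum_UNIV_remove2[OF ijk(1)]
        by (simp add: conjK_real_def qnorm2_def so3_vec_def)
    qed
    have "qnorm2 (?v (so3 i j k x z)) = qnorm2 (?v z)" by (simp add: v_so3 qnorm2_mult x)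
    moreover have "(\<Sum>l\<in>UNIV - {i, j} - {k}. so3 i j k x z $ l * so3 i j k x z $ l) =
        (\<Sum>l\<in>UNIV - {i, j} - {k}. z $ l * z $ l)"
      by (rule sum.cong) (auto simp: rest)
    ultimately show ?thesis unfolding inner by simp
  qed
  \<comment> \<open>This is the source of the factor \<open>2 * r\<close>, which vanishes exactly
    for half-turns.\<close>
  have "x * u * conjK x - conjK x * u * conjK (conjK x) = (2 * qRe x) *\<^sub>R (x * u - u * x)" for u :: quat
    by (simp add: quat_eq_iff algebra_simps)
  then show "so3 i j k x z - so3 i j k (conjK x) z = rscale (dso3 i j k x z) (of_real (2 * qRe x))"
    by (intro eqI) (simp_all add: v_so3 v_dso3 rest v_lin)
  show "dso3 i j k (x + y) z = dso3 i j k x z + dso3 i j k y z"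
    by (rule eqI) (simp_all add: v_dso3 rest v_lin algebra_simps)
  show "dso3 i j k (r *\<^sub>R x) z = rscale (dso3 i j k x z) (of_real r)"
    by (rule eqI) (simp_all add: v_dso3 rest v_lin algebra_simps)
  show "dso3 i j k 1 z = 0" by (rule eqI) (simp_all add: v_dso3 rest v_lin)
  show "dso3 i j k (x * y - y * x) z = dso3 i j k x (dso3 i j k y z) - dso3 i j k y (dso3 i j k x z)"
    by (rule eqI) (simp_all add: v_dso3 rest v_lin algebra_simps)
qed simp

section \<open>Paradoxical Grassmannians\<close>

text \<open>A subspace outside all \<open>M t\<close> would contradict \<open>Gr_not_spread\<close>,
  so finitely many doubling sets cover the Grassmannian.\<close>

lemma paradoxical_Gr_if_covered:
  fixes M :: "'i \<Rightarrow> ('a::conj_div_algebra ^ 'n::finite) set set"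
  assumes k: "1 \<le> k" "k < CARD('n)" and "finite J"
    and M: "\<And>t. t \<in> J \<Longrightarrow> isometry.doubling (M t)" "\<And>t. t \<in> J \<Longrightarrow> M t \<subseteq> Gr k"
    and spread: "\<And>V z i j. V \<in> Gr k \<Longrightarrow> (\<And>t. t \<in> J \<Longrightarrow> V \<notin> M t) \<Longrightarrow> z \<in> V \<Longrightarrow> z $ i \<noteq> 0 \<Longrightarrow> i \<noteq> j
      \<Longrightarrow> axis j 1 \<in> V"
  shows "paradoxical isometry_group (\<lambda>g V. g ` V) (Gr k :: ('a ^ 'n) set set)"
proof -
  have "V \<in> (\<Union>t\<in>J. M t)" if "V \<in> Gr k" for V
    using Gr_not_spread[OF that k] spread[OF that] by blast
  then have "Gr k = (\<Union>t\<in>J. M t)" using M(2) by blast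
  then have "isometry.doubling (Gr k :: ('a ^ 'n) set set)"
    using isometry.doubling_UN[of J M] assms(3) M(1) by simp
  then show ?thesis using Gr_nonempty[where 'a = 'a and 'n = 'n] k(2) by (intro isometry.paradoxical_if_doubling) auto
qed

lemma paradoxical_Gr_real:
  assumes k: "1 \<le> k" "k < CARD('n::finite)" and n: "CARD('n) \<ge> 3"
  shows "paradoxical isometry_group (\<lambda>g V. g ` V) (Gr k :: (real ^ 'n) set set)"
proof -
  define J :: "('n \<times> 'n \<times> 'n) set" where "J = {(i, j, l). i \<noteq> j \<and> i \<noteq> l \<and> j \<noteq> l}"
  define M where "M = (\<lambda>(i, j, l). quaternion_rep.moved (dso3 i j (l :: 'n)) k)"
  show ?thesis
  proof (rule paradoxical_Gr_if_covered[OF k, of J M])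
    show "finite J" by simp
    show "isometry.doubling (M t)" if "t \<in> J" for t
      using that quaternion_rep.doubling_moved[OF quaternion_rep_so3] by (auto simp: J_def M_def)
    show "M t \<subseteq> Gr k" if "t \<in> J" for t
    proof -
      obtain i j l where t: "t = (i, j, l)" "i \<noteq> j" "i \<noteq> l" "j \<noteq> l" using \<open>t \<in> J\<close> by (auto simp: J_def)
      then show ?thesis using quaternion_rep.moved_subset[OF quaternion_rep_so3[OF t(2-4)]] by (simp add: M_def)
    qed
    fix V z and i j :: 'n
    assume V: "V \<in> Gr k" "\<And>t. t \<in> J \<Longrightarrow> V \<notin> M t" and z: "z \<in> V" "z $ i \<noteq> 0" and ij: "i \<noteq> j"
    \<comment> \<open>Dimension at least 3 supplies the third coordinate of the rotation.\<close>
    have "\<not> UNIV \<subseteq> {i, j}" using n card_mono[of "{i, j}" UNIV] card_2_iff[of "{i, j}"] ij by auto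
    then obtain l where "l \<notin> {i, j}" by blast
    then have l: "i \<noteq> l" "j \<noteq> l" by auto
    note rep = quaternion_rep_so3[OF ij l]
    have "V \<notin> quaternion_rep.moved (dso3 i j l) k"
      using V(2)[of "(i, j, l)"] ij l by (simp add: J_def M_def)
    note D = quaternion_rep.D_mem_if_not_moved[OF rep V(1) this]
    have "dso3 i j l (Quat 0 1 0 0) (dso3 i j l (Quat 0 0 1 0) z) \<in> V" by (intro D z)
    \<comment> \<open>The inner bracket removes the \<open>j\<close>-th coordinate and sends the
      \<open>i\<close>-th to the \<open>l\<close>-th; the outer one removes the \<open>i\<close>-th
      and sends the \<open>l\<close>-th to the \<open>j\<close>-th. Each contributes a factor
      2.\<close>
    moreover have "dso3 i j l (Quat 0 1 0 0) (dso3 i j l (Quat 0 0 1 0) z) = axis j (4 * z $ i)"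
      using ij l by (auto simp: dso3_def so3_vec_def vec_eq_iff axis_def Let_def)
    ultimately show "axis j 1 \<in> V"
      using right_subspace_axis[OF Gr_right_subspace[OF V(1)]] z(2) by simp
  qed
qed

lemma paradoxical_Gr_complex:
  assumes k: "1 \<le> k" "k < CARD('n::finite)"
  shows "paradoxical isometry_group (\<lambda>g V. g ` V) (Gr k :: (complex ^ 'n) set set)"
proof -
  define J :: "('n \<times> 'n) set" where "J = {(i, j). i \<noteq> j}"
  define M where "M = (\<lambda>(i, j :: 'n). quaternion_rep.moved (cpx.dsu2 i j) k)"
  show ?thesis
  proof (rule paradoxical_Gr_if_covered[OF k, of J M])
    show "finite J" by simp
    show "isometry.doubling (M t)" if "t \<in> J" for t
      using that quaternion_rep.doubling_moved[OF cpx.quaternion_rep_su2] by (auto simp: J_def M_def)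
    show "M t \<subseteq> Gr k" if "t \<in> J" for t
      using that quaternion_rep.moved_subset[OF cpx.quaternion_rep_su2] by (auto simp: J_def M_def)
    fix V z and i j :: 'n
    assume V: "V \<in> Gr k" "\<And>t. t \<in> J \<Longrightarrow> V \<notin> M t" and z: "z \<in> V" "z $ i \<noteq> 0" and ij: "i \<noteq> j"
    note sub = Gr_right_subspace[OF V(1)]
    have "V \<notin> quaternion_rep.moved (cpx.dsu2 i j) k"
      using V(2)[of "(i, j)"] ij by (simp add: J_def M_def)
    note D = quaternion_rep.D_mem_if_not_moved[OF cpx.quaternion_rep_su2[OF ij] V(1) this]
    \<comment> \<open>At \<open>i, j\<close> the entries of \<open>w\<close> are
      \<open>z $ j, - z $ i\<close>, and those of \<open>w'\<close> are
      \<open>- z $ j, - z $ i\<close>; their sum isolates the \<open>j\<close>-th axis.\<close>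
    define w where "w = cpx.dsu2 i j (Quat 0 0 1 0) z"
    define w' where "w' = rscale (cpx.dsu2 i j (Quat 0 1 0 0) w) \<i>"
    have "w \<in> V" unfolding w_def by (intro D z)
    moreover have "w' \<in> V" unfolding w'_def by (intro right_subspace_rscale[OF sub] D) fact
    ultimately have "w + w' \<in> V" by (rule right_subspace_add[OF sub])
    moreover have "\<i> * c * \<i> = - c" for c
      by (simp add: mult.assoc mult.commute[of c] cpx.I_I_left)
    then have "w + w' = axis j (- 2 * z $ i)"
      using ij by (auto simp: w_def w'_def cpx.dsu2_def vec_eq_iff axis_def)
    ultimately show "axis j 1 \<in> V" using right_subspace_axis[OF sub] z(2) by simp
  qed
qed

text \<open>The complex argument uses \<open>\<i> * c * \<i> = - c\<close>, which fails for general
  quaternions. Here \<open>dlmul\<close> on the diagonal index \<open>(i, i)\<close> first isolates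
  the \<open>i\<close>-th axis, which \<open>qt.dsu2\<close> then carries to the
  \<open>j\<close>-th.\<close>

lemma paradoxical_Gr_quat:
  assumes k: "1 \<le> k" "k < CARD('n::finite)"
  shows "paradoxical isometry_group (\<lambda>g V. g ` V) (Gr k :: (quat ^ 'n) set set)"
proof -
  define M where "M = (\<lambda>(i, j :: 'n).
    if i = j then quaternion_rep.moved (dlmul i) k else quaternion_rep.moved (qt.dsu2 i j) k)"
  show ?thesis
  proof (rule paradoxical_Gr_if_covered[OF k, of UNIV M])
    show "finite (UNIV :: ('n \<times> 'n) set)" by simp
    show "isometry.doubling (M t)" for t
      using quaternion_rep.doubling_moved[OF quaternion_rep_lmul]
        quaternion_rep.doubling_moved[OF qt.quaternion_rep_su2] by (cases t) (auto simp: M_def)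
    show "M t \<subseteq> Gr k" for t
    proof (cases t)
      case (Pair i j)
      then show ?thesis
        using quaternion_rep.moved_subset[OF quaternion_rep_lmul[of i]]
          quaternion_rep.moved_subset[OF qt.quaternion_rep_su2[of i j]] by (auto simp: M_def)
    qed
    fix V z and i j :: 'n
    assume V: "V \<in> Gr k" "\<And>t. t \<in> UNIV \<Longrightarrow> V \<notin> M t" and z: "z \<in> V" "z $ i \<noteq> 0" and ij: "i \<noteq> j"
    note sub = Gr_right_subspace[OF V(1)]
    have "V \<notin> quaternion_rep.moved (dlmul i) k" using V(2)[of "(i, i)"] by (simp add: M_def)
    note D1 = quaternion_rep.D_mem_if_not_moved[OF quaternion_rep_lmul V(1) this]
    have "V \<notin> quaternion_rep.moved (qt.dsu2 i j) k" using V(2)[of "(i, j)"] ij by (simp add: M_def)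
    note D2 = quaternion_rep.D_mem_if_not_moved[OF qt.quaternion_rep_su2[OF ij] V(1) this]
    have "dlmul i (Quat 0 1 0 0) z = axis i (Quat 0 1 0 0 * z $ i)"
      by (simp add: dlmul_def)
    moreover have "Quat 0 1 0 0 * z $ i \<noteq> 0" using z(2) by (auto simp: quat_eq_iff)
    ultimately have "axis i 1 \<in> V" using right_subspace_axis[OF sub D1[OF z(1)]] by blast
    then have "qt.dsu2 i j (Quat 0 0 1 0) (axis i 1) \<in> V" by (rule D2)
    moreover have "qt.dsu2 i j (Quat 0 0 1 0) (axis i 1) = axis j (- 1)"
      using ij by (auto simp: qt.dsu2_def vec_eq_iff axis_def)
    ultimately show "axis j 1 \<in> V" using right_subspace_axis[OF sub] by simp
  qed
qed

theorem theorem2: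
  fixes k :: nat
  assumes "1 \<le> k" and "k \<le> CARD('n::finite) - 1"
  shows "(CARD('n) \<ge> 3 \<longrightarrow>
            paradoxical isometry_group (\<lambda>g V. g ` V) (Gr k :: (real ^ 'n) set set))
       \<and> (CARD('n) \<ge> 2 \<longrightarrow>
            paradoxical isometry_group (\<lambda>g V. g ` V) (Gr k :: (complex ^ 'n) set set))
       \<and> (CARD('n) \<ge> 2 \<longrightarrow>
            paradoxical isometry_group (\<lambda>g V. g ` V) (Gr k :: (quat ^ 'n) set set))"
proof -
  have "k < CARD('n)" using assms by linarith
  then show ?thesis
    using assms(1) paradoxical_Gr_real paradoxical_Gr_complex paradoxical_Gr_quat by blast
qed

end
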